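(* Let $\alpha_0,\alpha_1,\alpha_2,\alpha_3,\alpha_4$ be complex parameters with $\alpha_0+\alpha_1+2\alpha_2+2\alpha_3+\alpha_4=1$ and consider the Hamiltonian system $$\frac{dx}{dt}=\frac{\partial H}{\partial y},\quad \frac{dy}{dt}=-\frac{\partial H}{\partial x},\quad \frac{dz}{dt}=\frac{\partial H}{\partial w},\quad \frac{dw}{dt}=-\frac{\partial H}{\partial z}$$ with the polynomial Hamiltonian $H$ given by $$\begin{aligned} t(t-1)H =\;&x^2y^3-((t+1)x+2\alpha_2+\alpha_3+\alpha_4)xy^2\\ &+\{tx^2+(\alpha_0+2\alpha_2+\alpha_3+\alpha_4-(\alpha_0+\alpha_1)t)x+\alpha_2(\alpha_2+\alpha_3+\alpha_4)\}y+\alpha_1 t x\\ &+\tfrac{1}{4}\big[-z^2w^4+2\alpha_4 zw^3+((2t-1)z^2-\alpha_4^2)w^2\\ &\qquad-2\{-\alpha_0-2\alpha_2-\alpha_3-\alpha_4+(\alpha_4+1)t\}zw-t(t-1)z^2\big]\\ &+y((y-1)x-\alpha_2)zw. \end{aligned}$$ This system admits extended affine Weyl group symmetry of type $A_7^{(2)}$ as the group of its Bäcklund transformations, whose generators $s_0,\dots,s_4,\pi$ are defined as follows, with $( * ):=(x,y,z,w,t;\alpha_0,\alpha_1,\ldots,\alpha_4)$: $$\begin{aligned} s_0:( * ) \to &\left(x+\frac{\alpha_0}{y-1},y,z,w,t;-\alpha_0,\alpha_1,\alpha_2+\alpha_0,\alpha_3,\alpha_4 \right),\\ s_1:( * ) \to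 &\left(x+\frac{\alpha_1}{y},y,z,w,t;\alpha_0,-\alpha_1,\alpha_2+\alpha_1,\alpha_3,\alpha_4 \right),\\ s_2:( * ) \to &\left(x,y-\frac{\alpha_2}{x},z,w,t;\alpha_0+\alpha_2,\alpha_1+\alpha_2,-\alpha_2,\alpha_3+\alpha_2,\alpha_4 \right),\\ s_3:( * ) \to &\left(x+\frac{\alpha_3}{y+w^2-t},y,z+\frac{2\alpha_3 w}{y+w^2-t},w,t;\alpha_0,\alpha_1,\alpha_2+\alpha_3,-\alpha_3,\alpha_4+2\alpha_3 \right),\\ s_4:( * ) \to &\left(x,y,z,w-\frac{\alpha_4}{z},t;\alpha_0,\alpha_1,\alpha_2,\alpha_3+\alpha_4,-\alpha_4 \right),\\ \pi:( * ) \to &\left(-x,1-y,\sqrt{-1}\,z,\frac{w}{\sqrt{-1}},1-t;\alpha_1,\alpha_0,\alpha_2,\alpha_3,\alpha_4 \right). \end{aligned}$$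
   Context: A transformation written $(x,y,z,w,t;\alpha)\to(\tilde x,\tilde y,\tilde z,\tilde w,\tilde t;\tilde\alpha)$ is a Bäcklund transformation of the system if it is birational in $x,y,z,w$ and carries every solution of the system with parameters $\alpha$ and independent variable $t$ (on which the formulas are defined) to a solution of the same system with parameters $\tilde\alpha$ and independent variable $\tilde t$. Transformations are regarded as automorphisms of the field of rational functions in $x,y,z,w,t$ and the parameters (subject to the parameter relation), and products are compositions of automorphisms. The statement that the system admits extended affine Weyl group symmetry of type $A_7^{(2)}$ with generators $s_0,\dots,s_4,\pi$ means: each $s_i$ and $\pi$ is a Bäcklund transformation; $s_0,\dots,s_4$ satisfy the defining relations of the affine Weyl group $W(A_7^{(2)})$, namely $s_i^2=1$, $(s_0s_2)^3=(s_1s_2)^3=(s_2s_3)^3=1$, $(s_3s_4)^4=1$, and $s_is_j=s_js_i$ for all other pairs; and $\pi$ realizes the diagram automorphism exchanging nodes $0$ and $1$: $\pi s_0=s_1\pi$, $\pi s_1=s_0\pi$, $\pi s_j=s_j\pi$ for $j=2,3,4$. *)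

theory Defs
  imports
    "HOL-Analysis.Analysis"
    "HOL-Library.Poly_Mapping"
    "HOL-Computational_Algebra.Fraction_Field"
begin

datatype 'a params = Params (p0: 'a) (p1: 'a) (p2: 'a) (p3: 'a) (p4: 'a)

text \<open>The tuple \<open>(*) = (x, y, z, w, t; \<alpha>\<^sub>0, \<dots>, \<alpha>\<^sub>4)\<close>.\<close>

datatype 'a conf = Conf (cx: 'a) (cy: 'a) (cz: 'a) (cw: 'a) (ct: 'a) (cp: "'a params")

definition param_rel :: "complex params \<Rightarrow> bool" where
  "param_rel a \<longleftrightarrow> p0 a + p1 a + 2 * p2 a + 2 * p3 a + p4 a = 1"


section \<open>The Hamiltonian system\<close>

fun ham :: "complex params \<Rightarrow> complex \<Rightarrow> complex \<Rightarrow> complex \<Rightarrow> complex \<Rightarrow> complex \<Rightarrow> complex" where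
  "ham (Params a0 a1 a2 a3 a4) t x y z w =
    (x^2 * y^3 - ((t + 1) * x + 2 * a2 + a3 + a4) * x * y^2
     + (t * x^2 + (a0 + 2 * a2 + a3 + a4 - (a0 + a1) * t) * x + a2 * (a2 + a3 + a4)) * y
     + a1 * t * x
     + (1 / 4) * (- (z^2 * w^4) + 2 * a4 * z * w^3 + ((2 * t - 1) * z^2 - a4^2) * w^2
                  - 2 * (- a0 - 2 * a2 - a3 - a4 + (a4 + 1) * t) * z * w
                  - t * (t - 1) * z^2)
     + y * ((y - 1) * x - a2) * z * w) / (t * (t - 1))"

text \<open>Solutions are holomorphic, on an arbitrary open set avoiding the fixed singularities
  \<open>t = 0, 1\<close>.\<close>

definition solution ::
    "complex params \<Rightarrow> complex set \<Rightarrow> (complex \<Rightarrow> complex) \<Rightarrow> (complex \<Rightarrow> complex) \<Rightarrow>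
      (complex \<Rightarrow> complex) \<Rightarrow> (complex \<Rightarrow> complex) \<Rightarrow> bool" where
  "solution a D x y z w \<longleftrightarrow>
    param_rel a \<and> open D \<and> 0 \<notin> D \<and> 1 \<notin> D \<and>
    (\<forall>t\<in>D.
      (x has_field_derivative deriv (\<lambda>v. ham a t (x t) v (z t) (w t)) (y t)) (at t) \<and>
      (y has_field_derivative - deriv (\<lambda>u. ham a t u (y t) (z t) (w t)) (x t)) (at t) \<and>
      (z has_field_derivative deriv (\<lambda>v. ham a t (x t) (y t) (z t) v) (w t)) (at t) \<and>
      (w has_field_derivative - deriv (\<lambda>u. ham a t (x t) (y t) u (w t)) (z t)) (at t))"


section \<open>The field of rational functions\<close>

text \<open>Imposing the parameter relation on the ten variables amounts to eliminating \<open>\<alpha>\<^sub>0\<close>, so the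
  field is the rational function field over the complex numbers in the remaining nine variables.
  The linear order on the variables has no mathematical content; it is needed only for the
  library instance saying that the polynomial ring is an integral domain.\<close>

datatype var = VX | VY | VZ | VW | VT | VA1 | VA2 | VA3 | VA4

fun var_index :: "var \<Rightarrow> nat" where
  "var_index VX = 0" | "var_index VY = 1" | "var_index VZ = 2" | "var_index VW = 3"
| "var_index VT = 4" | "var_index VA1 = 5" | "var_index VA2 = 6" | "var_index VA3 = 7"
| "var_index VA4 = 8"

lemma var_index_inject: "var_index u = var_index v \<Longrightarrow> u = v"
  by (cases u; cases v) simp_all

instantiation var :: linorder
begin

definition less_eq_var :: "var \<Rightarrow> var \<Rightarrow> bool" where
  "less_eq_var u v \<longleftrightarrow> var_index u \<le> var_index v"

definition less_var :: "var \<Rightarrow> var \<Rightarrow> bool" where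
  "less_var u v \<longleftrightarrow> var_index u < var_index v"

instance
  by standard (auto simp: less_eq_var_def less_var_def intro: var_index_inject)

end

type_synonym mpol = "(var \<Rightarrow>\<^sub>0 nat) \<Rightarrow>\<^sub>0 complex"

type_synonym ratfun = "mpol fract"

definition const :: "complex \<Rightarrow> ratfun" where
  "const c = Fract (Poly_Mapping.single 0 c) 1"

definition gen :: "var \<Rightarrow> ratfun" where
  "gen v = Fract (Poly_Mapping.single (Poly_Mapping.single v 1) 1) 1"

definition generic :: "ratfun conf" where
  "generic = Conf (gen VX) (gen VY) (gen VZ) (gen VW) (gen VT)
     (Params (1 - gen VA1 - 2 * gen VA2 - 2 * gen VA3 - gen VA4)
        (gen VA1) (gen VA2) (gen VA3) (gen VA4))"


text \<open>Evaluation at a complex tuple. The value of \<open>\<alpha>\<^sub>0\<close> is ignored, since evaluation is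
  only used at tuples satisfying the parameter relation. A rational function is regular at a
  tuple if some representation of it as a quotient has non-vanishing denominator there.\<close>

fun coord :: "complex conf \<Rightarrow> var \<Rightarrow> complex" where
  "coord c VX = cx c" | "coord c VY = cy c" | "coord c VZ = cz c" | "coord c VW = cw c"
| "coord c VT = ct c" | "coord c VA1 = p1 (cp c)" | "coord c VA2 = p2 (cp c)"
| "coord c VA3 = p3 (cp c)" | "coord c VA4 = p4 (cp c)"

definition pol_value :: "mpol \<Rightarrow> complex conf \<Rightarrow> complex" where
  "pol_value p c =
    (\<Sum>m\<in>Poly_Mapping.keys p. Poly_Mapping.lookup p m *
       (\<Prod>v\<in>Poly_Mapping.keys m. coord c v ^ Poly_Mapping.lookup m v))"

definition regular_at :: "ratfun \<Rightarrow> complex conf \<Rightarrow> bool" where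
  "regular_at f c \<longleftrightarrow> (\<exists>p q. f = Fract p q \<and> pol_value q c \<noteq> 0)"

definition rat_value :: "ratfun \<Rightarrow> complex conf \<Rightarrow> complex" where
  "rat_value f c =
    (THE v. \<exists>p q. f = Fract p q \<and> pol_value q c \<noteq> 0 \<and> v = pol_value p c / pol_value q c)"


section \<open>Transformations as field automorphisms\<close>

text \<open>A transformation \<open>(*) \<rightarrow> \<tau>\<close> is given by the tuple \<open>\<tau>\<close> of rational functions. The
  automorphism it induces sends each coordinate of \<open>(*)\<close> to the corresponding entry of \<open>\<tau>\<close>;
  it is unique because the coordinates generate the field over the complex numbers.\<close>

definition field_automorphism :: "(ratfun \<Rightarrow> ratfun) \<Rightarrow> bool" where
  "field_automorphism \<phi> \<longleftrightarrow>
    bij \<phi> \<and> (\<forall>f g. \<phi> (f + g) = \<phi> f + \<phi> g) \<and> (\<forall>f g. \<phi> (f * g) = \<phi> f * \<phi> g) \<and>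
    (\<forall>c. \<phi> (const c) = const c)"

definition induces :: "ratfun conf \<Rightarrow> (ratfun \<Rightarrow> ratfun) \<Rightarrow> bool" where
  "induces \<tau> \<phi> \<longleftrightarrow> field_automorphism \<phi> \<and> map_conf \<phi> generic = \<tau>"


section \<open>Baecklund transformations\<close>

type_synonym ratmap = "ratfun \<times> ratfun \<times> ratfun \<times> ratfun"

text \<open>For fixed \<open>t\<close> and \<open>\<alpha>\<close>, four rational functions define a rational self-map of the
  \<open>(x, y, z, w)\<close>-space, which is here carried along with the unchanged \<open>t\<close> and \<open>\<alpha>\<close>.\<close>

fun ratmap_regular_at :: "ratmap \<Rightarrow> complex conf \<Rightarrow> bool" where
  "ratmap_regular_at (f, g, h, k) c \<longleftrightarrow>
    regular_at f c \<and> regular_at g c \<and> regular_at h c \<and> regular_at k c"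

fun ratmap_value :: "ratmap \<Rightarrow> complex conf \<Rightarrow> complex conf" where
  "ratmap_value (f, g, h, k) c =
    Conf (rat_value f c) (rat_value g c) (rat_value h c) (rat_value k c) (ct c) (cp c)"

text \<open>\<open>G \<circ> F\<close> is defined and equal to the identity on a non-empty Zariski open set.\<close>

definition generic_left_inverse ::
    "complex \<Rightarrow> complex params \<Rightarrow> ratmap \<Rightarrow> ratmap \<Rightarrow> bool" where
  "generic_left_inverse t a G F \<longleftrightarrow>
    (\<exists>d. (\<exists>x y z w. pol_value d (Conf x y z w t a) \<noteq> 0) \<and>
      (\<forall>x y z w. let c = Conf x y z w t a in
        pol_value d c \<noteq> 0 \<longrightarrow>
          ratmap_regular_at F c \<and> ratmap_regular_at G (ratmap_value F c) \<and>
          ratmap_value G (ratmap_value F c) = c))"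

definition birational_xyzw :: "ratfun conf \<Rightarrow> bool" where
  "birational_xyzw \<tau> \<longleftrightarrow>
    (\<forall>t a. param_rel a \<longrightarrow>
      (\<exists>G. generic_left_inverse t a G (cx \<tau>, cy \<tau>, cz \<tau>, cw \<tau>) \<and>
           generic_left_inverse t a (cx \<tau>, cy \<tau>, cz \<tau>, cw \<tau>) G))"

text \<open>The transformed functions \<open>X, Y, Z, W\<close> are functions of the new independent variable,
  hence evaluated at the value of the \<open>t\<close>-entry of \<open>\<tau>\<close>, and \<open>b\<close> are the new parameters.\<close>

definition carries_solutions :: "ratfun conf \<Rightarrow> bool" where
  "carries_solutions \<tau> \<longleftrightarrow>
    (\<forall>a D x y z w.
      let c = (\<lambda>t. Conf (x t) (y t) (z t) (w t) t a);
          s = (\<lambda>t. rat_value (ct \<tau>) (c t))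
      in solution a D x y z w \<longrightarrow> (\<forall>t\<in>D. pred_conf (\<lambda>f. regular_at f (c t)) \<tau>) \<longrightarrow>
        (\<exists>b X Y Z W. solution b (s ` D) X Y Z W \<and>
          (\<forall>t\<in>D. map_conf (\<lambda>f. rat_value f (c t)) \<tau> =
            Conf (X (s t)) (Y (s t)) (Z (s t)) (W (s t)) (s t) b)))"

definition baecklund :: "ratfun conf \<Rightarrow> bool" where
  "baecklund \<tau> \<longleftrightarrow> birational_xyzw \<tau> \<and> carries_solutions \<tau>"


section \<open>The generators\<close>

definition tr_s0 :: "ratfun conf" where
  "tr_s0 = (case generic of Conf x y z w t (Params a0 a1 a2 a3 a4) \<Rightarrow>
    Conf (x + a0 / (y - 1)) y z w t (Params (- a0) a1 (a2 + a0) a3 a4))"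

definition tr_s1 :: "ratfun conf" where
  "tr_s1 = (case generic of Conf x y z w t (Params a0 a1 a2 a3 a4) \<Rightarrow>
    Conf (x + a1 / y) y z w t (Params a0 (- a1) (a2 + a1) a3 a4))"

definition tr_s2 :: "ratfun conf" where
  "tr_s2 = (case generic of Conf x y z w t (Params a0 a1 a2 a3 a4) \<Rightarrow>
    Conf x (y - a2 / x) z w t (Params (a0 + a2) (a1 + a2) (- a2) (a3 + a2) a4))"

definition tr_s3 :: "ratfun conf" where
  "tr_s3 = (case generic of Conf x y z w t (Params a0 a1 a2 a3 a4) \<Rightarrow>
    Conf (x + a3 / (y + w^2 - t)) y (z + 2 * a3 * w / (y + w^2 - t)) w t
      (Params a0 a1 (a2 + a3) (- a3) (a4 + 2 * a3)))"

definition tr_s4 :: "ratfun conf" where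
  "tr_s4 = (case generic of Conf x y z w t (Params a0 a1 a2 a3 a4) \<Rightarrow>
    Conf x y z (w - a4 / z) t (Params a0 a1 a2 (a3 + a4) (- a4)))"

definition tr_pi :: "ratfun conf" where
  "tr_pi = (case generic of Conf x y z w t (Params a0 a1 a2 a3 a4) \<Rightarrow>
    Conf (- x) (1 - y) (const \<i> * z) (w / const \<i>) (1 - t) (Params a1 a0 a2 a3 a4))"

end

theory Submission
  imports Defs
begin

text \<open>
  \<^bold>\<open>Solutions go to solutions.\<close> Each \<open>s\<^sub>i\<close> adds multiples of \<open>r = \<alpha>\<^sub>i / f\<^sub>i\<close> to some coordinates, where
  \<open>f\<^sub>i\<close> is \<open>y - 1\<close>, \<open>y\<close>, \<open>x\<close>, \<open>y + w\<^sup>2 - t\<close> or \<open>z\<close>. The hypersurface \<open>f\<^sub>i = 0\<close> is invariant under the flow when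
  \<open>\<alpha>\<^sub>i = 0\<close>, so after writing \<open>\<alpha>\<^sub>i = r f\<^sub>i\<close> the derivative of \<open>f\<^sub>i\<close> along the flow is divisible by \<open>f\<^sub>i\<close>
  and, apart from the factor \<open>1 / (t (t - 1))\<close>, the derivative of \<open>r\<close> is a polynomial in \<open>r\<close>, the
  coordinates, the time and the parameters. The claim about solutions thus becomes a
  handful of polynomial identities between partial derivatives of the Hamiltonian
  (\<open>s0_vector_field\<close> and its analogues); \<open>\<pi>\<close> reverses both the time and the sign of the Hamiltonian.

  One has to know that \<open>f\<^sub>i\<close> has no zero on the solution, given only that the entries of the
  transformation are regular there. This must include the case where \<open>\<alpha>\<^sub>i\<close> vanishes at the given
  parameters, in which \<open>\<alpha>\<^sub>i / f\<^sub>i\<close> has an indeterminate form. Regularity is an open condition, and moving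
  the parameter \<open>\<alpha>\<^sub>i\<close> slightly makes the numerator non-zero while \<open>f\<^sub>i\<close> stays the same
  (\<open>denominator_nonzero_if_regular\<close>).

  \<^bold>\<open>Automorphisms.\<close> A polynomial can be evaluated at complex numbers or at rational functions, and
  either evaluation extends to those fractions that have a representation whose denominator is not
  killed. Treating both as instances of one notion (\<open>value_under\<close>) gives the values of rational
  functions at points and the action of substitutions with the same calculus. A substitution \<open>\<tau>\<close>
  is an automorphism as soon as it and another one undo each other on the nine variables: the other
  evaluates \<open>\<tau>(p)\<close> back to \<open>p\<close>, so \<open>\<tau>\<close> kills no polynomial (\<open>left_inverse_injective\<close>).

  \<^bold>\<open>Relations.\<close> Endomorphisms that agree on the nine variables are equal (\<open>ratfun_hom_eqI\<close>). The three braid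
  relations of length three are instances of one identity (\<open>braid_identity\<close>): \<open>s\<^sub>0\<close>, \<open>s\<^sub>1\<close> and \<open>s\<^sub>3\<close> are
  related to \<open>s\<^sub>2\<close> in the same way, with \<open>f\<^sub>i\<close> in the role of a variable conjugate to \<open>x\<close>. The relation of
  length four between \<open>s\<^sub>3\<close> and \<open>s\<^sub>4\<close> is proved by closed forms whose invariance under the last reflection is
  visible (\<open>square_relation_s3_s4\<close>). The nested denominators that occur do not
  vanish, since each is the image of a non-zero element under a field homomorphism.
\<close>

section \<open>Evaluation of polynomials\<close>

definition mconst :: "complex \<Rightarrow> mpol" where
  "mconst c = Poly_Mapping.single 0 c"

definition mvar :: "var \<Rightarrow> mpol" where
  "mvar v = Poly_Mapping.single (Poly_Mapping.single v 1) 1"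

lemma poly_mapping_eq_sum_single:
  fixes p :: "'k \<Rightarrow>\<^sub>0 'a::comm_monoid_add"
  shows "p = (\<Sum>k\<in>Poly_Mapping.keys p. Poly_Mapping.single k (Poly_Mapping.lookup p k))"
  by (rule poly_mapping_eqI)
    (auto simp: lookup_sum lookup_single when_def in_keys_iff sum.delta' finite_keys
      intro!: sum.neutral)

lemma monomial_eq_prod:
  "Poly_Mapping.single m c = mconst c * (\<Prod>v\<in>Poly_Mapping.keys m. mvar v ^ Poly_Mapping.lookup m v)"
proof -
  have power: "mvar v ^ n = Poly_Mapping.single (Poly_Mapping.single v n) 1" for v n
    by (induction n) (simp_all add: mvar_def mult_single flip: single_add)
  have "Poly_Mapping.single (\<Sum>v\<in>A. e v) 1 = (\<Prod>v\<in>A. Poly_Mapping.single (e v) (1::complex))"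
    if "finite A" for A :: "var set" and e :: "var \<Rightarrow> var \<Rightarrow>\<^sub>0 nat"
    using that
  proof (induction A rule: finite_induct)
    case (insert v A)
    then show ?case by (simp flip: insert.IH add: mult_single)
  qed simp
  then have "Poly_Mapping.single m (1::complex) = (\<Prod>v\<in>Poly_Mapping.keys m. mvar v ^ Poly_Mapping.lookup m v)"
    unfolding power using poly_mapping_eq_sum_single[of m] by (metis finite_keys)
  then show ?thesis
    by (simp add: mconst_def mult_single flip: \<open>Poly_Mapping.single m (1::complex) = _\<close>)
qed

text \<open>Polynomials enter the later arguments only through maps that respect sums and products; this
  principle spares those arguments the expansion into monomials.\<close>

lemma mpol_induct [case_names const var add mult]:
  assumes const: "\<And>c. P (mconst c)" and var: "\<And>v. P (mvar v)"
    and add: "\<And>p q. P p \<Longrightarrow> P q \<Longrightarrow> P (p + q)"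
    and mult: "\<And>p q. P p \<Longrightarrow> P q \<Longrightarrow> P (p * q)"
  shows "P p"
proof -
  have one: "P 1" using const[of 1] by (simp add: mconst_def)
  have pow: "P (mvar v ^ n)" for v n
    by (induction n) (auto intro: one mult var)
  have "P (\<Prod>v\<in>A. mvar v ^ e v)" if "finite A" for A e
    using that by (induction A rule: finite_induct) (auto intro: one mult pow)
  then have mono: "P (Poly_Mapping.single m c)" for m c
    unfolding monomial_eq_prod by (intro mult const) simp
  have zero: "P 0" using const[of 0] by (simp add: mconst_def)
  have "P (\<Sum>k\<in>A. Poly_Mapping.single k (e k))" if "finite A" for A e
    using that by (induction A rule: finite_induct) (auto intro: zero add mono)
  then show ?thesis using poly_mapping_eq_sum_single[of p] by (metis finite_keys)
qed

text \<open>The target is an arbitrary ring, because two targets occur: the complex numbers, for values at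
  points, and the field of rational functions, for substitutions.\<close>

definition eval_mpoly :: "(complex \<Rightarrow> 'b::comm_ring_1) \<Rightarrow> (var \<Rightarrow> 'b) \<Rightarrow> mpol \<Rightarrow> 'b" where
  "eval_mpoly \<kappa> \<sigma> p = (\<Sum>m\<in>Poly_Mapping.keys p. \<kappa> (Poly_Mapping.lookup p m) *
     (\<Prod>v\<in>Poly_Mapping.keys m. \<sigma> v ^ Poly_Mapping.lookup m v))"

locale coefficient_hom =
  fixes \<kappa> :: "complex \<Rightarrow> 'b::comm_ring_1"
  assumes kappa_add: "\<kappa> (a + b) = \<kappa> a + \<kappa> b"
    and kappa_mult: "\<kappa> (a * b) = \<kappa> a * \<kappa> b"
    and kappa_one: "\<kappa> 1 = 1"
begin

lemma kappa_zero: "\<kappa> 0 = 0"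
  using kappa_add[of 0 0] by simp

lemma eval_add: "eval_mpoly \<kappa> \<sigma> (p + q) = eval_mpoly \<kappa> \<sigma> p + eval_mpoly \<kappa> \<sigma> q"
  unfolding eval_mpoly_def
  by (rule setsum_keys_plus_distrib) (simp_all add: kappa_zero kappa_add algebra_simps)

lemma eval_zero: "eval_mpoly \<kappa> \<sigma> 0 = 0"
  by (simp add: eval_mpoly_def)

lemma eval_sum: "eval_mpoly \<kappa> \<sigma> (sum f A) = (\<Sum>i\<in>A. eval_mpoly \<kappa> \<sigma> (f i))"
  by (induction A rule: infinite_finite_induct) (simp_all add: eval_zero eval_add)

lemma eval_single:
  "eval_mpoly \<kappa> \<sigma> (Poly_Mapping.single m c) =
     \<kappa> c * (\<Prod>v\<in>Poly_Mapping.keys m. \<sigma> v ^ Poly_Mapping.lookup m v)"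
  by (cases "c = 0") (simp_all add: eval_mpoly_def kappa_zero)

lemma eval_const: "eval_mpoly \<kappa> \<sigma> (mconst c) = \<kappa> c"
  by (simp add: mconst_def eval_single)

lemma eval_var: "eval_mpoly \<kappa> \<sigma> (mvar v) = \<sigma> v"
  by (simp add: mvar_def eval_single kappa_one)

lemma eval_mult: "eval_mpoly \<kappa> \<sigma> (p * q) = eval_mpoly \<kappa> \<sigma> p * eval_mpoly \<kappa> \<sigma> q"
proof -
  define M where "M m = (\<Prod>v\<in>Poly_Mapping.keys m. \<sigma> v ^ Poly_Mapping.lookup m v)"
    for m :: "var \<Rightarrow>\<^sub>0 nat"
  have M_superset: "M m = (\<Prod>v\<in>A. \<sigma> v ^ Poly_Mapping.lookup m v)"
    if "finite A" "Poly_Mapping.keys m \<subseteq> A" for m A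
    unfolding M_def by (rule prod.mono_neutral_left) (use that in \<open>auto simp: in_keys_iff\<close>)
  have M_add: "M (m + n) = M m * M n" for m n
  proof -
    let ?A = "Poly_Mapping.keys m \<union> Poly_Mapping.keys n"
    have "M (m + n) = (\<Prod>v\<in>?A. \<sigma> v ^ Poly_Mapping.lookup (m + n) v)"
      by (rule M_superset) (simp_all add: Poly_Mapping.keys_add)
    also have "\<dots> = (\<Prod>v\<in>?A. \<sigma> v ^ Poly_Mapping.lookup m v) * (\<Prod>v\<in>?A. \<sigma> v ^ Poly_Mapping.lookup n v)"
      by (simp add: lookup_add power_add prod.distrib)
    finally show ?thesis by (simp add: M_superset[of ?A])
  qed
  have single: "eval_mpoly \<kappa> \<sigma> (Poly_Mapping.single m c) = \<kappa> c * M m" for m c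
    by (simp add: eval_single M_def)
  have "p * q = (\<Sum>m\<in>Poly_Mapping.keys p. \<Sum>n\<in>Poly_Mapping.keys q.
      Poly_Mapping.single (m + n) (Poly_Mapping.lookup p m * Poly_Mapping.lookup q n))"
    by (subst poly_mapping_eq_sum_single[of p], subst poly_mapping_eq_sum_single[of q])
      (simp add: sum_product mult_single)
  then have "eval_mpoly \<kappa> \<sigma> (p * q) = (\<Sum>m\<in>Poly_Mapping.keys p. \<Sum>n\<in>Poly_Mapping.keys q.
      (\<kappa> (Poly_Mapping.lookup p m) * M m) * (\<kappa> (Poly_Mapping.lookup q n) * M n))"
    by (simp add: eval_sum single kappa_mult M_add mult_ac)
  then show ?thesis
    by (simp add: eval_mpoly_def sum_product M_def)
qed

end

section \<open>Values of fractions under a partially defined homomorphism\<close>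

definition defined_under :: "('a::idom \<Rightarrow> 'b::field) \<Rightarrow> 'a fract \<Rightarrow> bool" where
  "defined_under h f \<longleftrightarrow> (\<exists>p q. f = Fract p q \<and> h q \<noteq> 0)"

definition value_under :: "('a::idom \<Rightarrow> 'b::field) \<Rightarrow> 'a fract \<Rightarrow> 'b" where
  "value_under h f = (THE v. \<exists>p q. f = Fract p q \<and> h q \<noteq> 0 \<and> v = h p / h q)"

text \<open>A homomorphism from a domain to a field need not be injective, so it extends only to the fractions
  that admit a representation with denominator outside the kernel. This is the localisation at the
  kernel, which is a ring but in general not the whole fraction field.\<close>

locale hom_to_field =
  fixes h :: "'a::idom \<Rightarrow> 'b::field"
  assumes h_add: "h (p + q) = h p + h q"
    and h_mult: "h (p * q) = h p * h q"
    and h_one: "h 1 = 1"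
begin

lemma h_zero: "h 0 = 0"
  using h_add[of 0 0] by (metis add.right_neutral add_left_cancel)

lemma h_minus: "h (- p) = - h p"
  using h_add[of "- p" p] by (simp add: h_zero eq_neg_iff_add_eq_0)

lemma value_Fract:
  assumes "h q \<noteq> 0"
  shows "value_under h (Fract p q) = h p / h q"
  unfolding value_under_def
proof (rule the_equality)
  fix v
  assume "\<exists>p' q'. Fract p q = Fract p' q' \<and> h q' \<noteq> 0 \<and> v = h p' / h q'"
  then obtain p' q' where *: "Fract p q = Fract p' q'" "h q' \<noteq> 0" "v = h p' / h q'"
    by blast
  have "q \<noteq> 0" "q' \<noteq> 0" using assms *(2) h_zero by auto
  then have "p * q' = p' * q" using *(1) by (simp add: eq_fract)
  then have "h p * h q' = h p' * h q" by (metis h_mult)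
  then show "v = h p / h q" using *(2,3) assms by (simp add: frac_eq_eq)
qed (use assms in blast)

lemma defined_Fract: "h q \<noteq> 0 \<Longrightarrow> defined_under h (Fract p q)"
  by (auto simp: defined_under_def)

lemma defined_cases:
  assumes "defined_under h f"
  obtains p q where "f = Fract p q" "h q \<noteq> 0" "q \<noteq> 0" "value_under h f = h p / h q"
  using assms value_Fract h_zero by (auto simp: defined_under_def)

lemma value_of_poly [simp]: "value_under h (Fract p 1) = h p"
  by (simp add: value_Fract h_one)

lemma defined_of_poly [simp]: "defined_under h (Fract p 1)"
  by (simp add: defined_Fract h_one)

lemma
  assumes "defined_under h f" "defined_under h g"
  shows defined_add [simp]: "defined_under h (f + g)"
    and value_add [simp]: "value_under h (f + g) = value_under h f + value_under h g"
    and defined_mult [simp]: "defined_under h (f * g)"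
    and value_mult [simp]: "value_under h (f * g) = value_under h f * value_under h g"
proof -
  obtain p q where f: "f = Fract p q" "h q \<noteq> 0" "q \<noteq> 0" "value_under h f = h p / h q"
    using assms(1) by (rule defined_cases)
  obtain p' q' where g: "g = Fract p' q'" "h q' \<noteq> 0" "q' \<noteq> 0" "value_under h g = h p' / h q'"
    using assms(2) by (rule defined_cases)
  have "f + g = Fract (p * q' + p' * q) (q * q')" "f * g = Fract (p * p') (q * q')"
    using f g by simp_all
  moreover have "h (q * q') \<noteq> 0" using f g by (simp add: h_mult)
  ultimately show "defined_under h (f + g)" "defined_under h (f * g)"
    "value_under h (f + g) = value_under h f + value_under h g"
    "value_under h (f * g) = value_under h f * value_under h g"
    using f g by (simp_all add: value_Fract defined_Fract h_add h_mult field_simps)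
qed

lemma
  assumes "defined_under h f"
  shows defined_minus [simp]: "defined_under h (- f)"
    and value_minus [simp]: "value_under h (- f) = - value_under h f"
  using assms by (auto elim!: defined_cases simp: value_Fract defined_Fract h_minus)

lemma
  assumes "defined_under h f" "value_under h f \<noteq> 0"
  shows defined_inverse: "defined_under h (inverse f)"
    and value_inverse: "value_under h (inverse f) = inverse (value_under h f)"
  using assms by (auto elim!: defined_cases simp: value_Fract defined_Fract)

lemma
  assumes "defined_under h f" "defined_under h g" "value_under h g \<noteq> 0"
  shows defined_divide [simp]: "defined_under h (f / g)"
    and value_divide [simp]: "value_under h (f / g) = value_under h f / value_under h g"
  unfolding divide_inverse using assms by (simp_all add: defined_inverse value_inverse)

lemma
  assumes "defined_under h f" "defined_under h g"
  shows defined_diff [simp]: "defined_under h (f - g)"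
    and value_diff [simp]: "value_under h (f - g) = value_under h f - value_under h g"
  unfolding diff_conv_add_uminus using assms by (simp_all del: add_uminus_conv_diff)

lemma defined_one [simp]: "defined_under h 1"
  and value_one [simp]: "value_under h 1 = 1"
  by (simp_all add: One_fract_def h_one)

lemma defined_zero [simp]: "defined_under h 0"
  and value_zero [simp]: "value_under h 0 = 0"
  by (simp_all add: Zero_fract_def h_zero)

lemma
  shows defined_numeral [simp]: "defined_under h (numeral n)"
    and value_numeral [simp]: "value_under h (numeral n) = numeral n"
  by (induction n) (simp_all only: numeral.simps defined_one value_one defined_add value_add simp_thms)

lemma
  assumes "defined_under h f"
  shows defined_power [simp]: "defined_under h (f ^ n)"
    and value_power [simp]: "value_under h (f ^ n) = value_under h f ^ n"
proof (induction n)
  case (Suc n)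
  { case 1 show ?case using Suc assms by simp
  next
    case 2 show ?case using Suc assms by simp }
qed simp_all

end

section \<open>Substitutions as field automorphisms\<close>

lemma const_eq: "const c = Fract (mconst c) 1"
  by (simp add: const_def mconst_def)

lemma gen_eq: "gen v = Fract (mvar v) 1"
  by (simp add: gen_def mvar_def)

lemma const_add: "const (a + b) = const a + const b"
  by (simp add: const_def single_add)

lemma const_mult: "const (a * b) = const a * const b"
  by (simp add: const_def mult_single)

lemma const_one: "const 1 = 1"
  by (simp add: const_def One_fract_def)

lemma const_minus: "const (- a) = - const a"
  by (simp add: const_def single_uminus)

interpretation const: coefficient_hom const
  by standard (simp_all add: const_add const_mult const_one)

text \<open>There is no entry for \<open>\<alpha>\<^sub>0\<close>: it is not a variable of the field, being determined by the
  parameter relation.\<close>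

fun entry :: "'a conf \<Rightarrow> var \<Rightarrow> 'a" where
  "entry c VX = cx c" | "entry c VY = cy c" | "entry c VZ = cz c" | "entry c VW = cw c"
| "entry c VT = ct c" | "entry c VA1 = p1 (cp c)" | "entry c VA2 = p2 (cp c)"
| "entry c VA3 = p3 (cp c)" | "entry c VA4 = p4 (cp c)"

declare entry.simps [simp del]

definition substitute :: "ratfun conf \<Rightarrow> mpol \<Rightarrow> ratfun" where
  "substitute \<tau> = eval_mpoly const (entry \<tau>)"

lemma substitute_const: "substitute \<tau> (mconst c) = const c"
  and substitute_var: "substitute \<tau> (mvar v) = entry \<tau> v"
  by (simp_all add: substitute_def const.eval_const const.eval_var)

definition subst_ratfun :: "ratfun conf \<Rightarrow> ratfun \<Rightarrow> ratfun" where
  "subst_ratfun \<tau> = value_under (substitute \<tau>)"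

interpretation subst: hom_to_field "substitute \<tau>" for \<tau>
  by standard (use substitute_const[of _ 1] in
    \<open>simp_all add: substitute_def const.eval_add const.eval_mult mconst_def const_one\<close>)

lemma subst_defined_gen [simp]: "defined_under (substitute \<tau>) (gen v)"
  and subst_value_gen: "value_under (substitute \<tau>) (gen v) = entry \<tau> v"
  and subst_defined_const [simp]: "defined_under (substitute \<tau>) (const c)"
  and subst_value_const: "value_under (substitute \<tau>) (const c) = const c"
  by (simp_all add: gen_eq const_eq substitute_const substitute_var)

text \<open>Definedness is demanded separately because, before injectivity is known, \<open>\<tau>'\<close> might kill a
  denominator of \<open>\<tau>\<close>, and then \<open>value_under\<close> is an arbitrary element.\<close>

definition left_inverse :: "ratfun conf \<Rightarrow> ratfun conf \<Rightarrow> bool" where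
  "left_inverse \<tau>' \<tau> \<longleftrightarrow> (\<forall>v. defined_under (substitute \<tau>') (entry \<tau> v) \<and>
     value_under (substitute \<tau>') (entry \<tau> v) = gen v)"

text \<open>Evaluating \<open>\<tau>(p)\<close> under \<open>\<tau>'\<close> returns \<open>p\<close>: this holds for variables by assumption and
  is preserved by sums and products, since values under \<open>\<tau>'\<close> are. Hence \<open>\<tau>(p) = 0\<close> forces \<open>p = 0\<close>.\<close>

lemma left_inverse_injective:
  assumes "left_inverse \<tau>' \<tau>" "substitute \<tau> p = 0"
  shows "p = 0"
proof -
  let ?h = "substitute \<tau>" and ?h' = "substitute \<tau>'"
  have "defined_under ?h' (?h p) \<and> value_under ?h' (?h p) = Fract p 1" for p
  proof (induction p rule: mpol_induct)
    case (const c)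
    then show ?case by (simp add: substitute_const subst_value_const) (simp add: const_eq)
  next
    case (var v)
    then show ?case using assms(1) by (simp add: substitute_var left_inverse_def gen_eq)
  qed (simp_all add: subst.h_add subst.h_mult)
  from this[of p] have "Fract p 1 = (0 :: ratfun)"
    using assms(2) by simp
  then show ?thesis by (simp add: Zero_fract_def eq_fract)
qed

locale substitution =
  fixes \<tau> \<tau>'
  assumes left_inv: "left_inverse \<tau>' \<tau>"
begin

lemma defined [simp]: "defined_under (substitute \<tau>) f"
proof (cases f)
  case (Fract p q)
  then have "substitute \<tau> q \<noteq> 0"
    using left_inverse_injective[OF left_inv] by blast
  then show ?thesis unfolding Fract by (rule subst.defined_Fract)
qed

end

locale ratfun_hom =
  fixes \<phi> :: "ratfun \<Rightarrow> ratfun"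
  assumes hom_add: "\<phi> (f + g) = \<phi> f + \<phi> g"
    and hom_mult: "\<phi> (f * g) = \<phi> f * \<phi> g"
    and hom_const: "\<phi> (const c) = const c"
begin

lemma hom_one: "\<phi> 1 = 1"
  using hom_const[of 1] by (simp add: const_one)

lemma hom_zero: "\<phi> 0 = 0"
  using hom_add[of 0 0] by (metis add.right_neutral add_left_cancel)

lemma hom_minus: "\<phi> (- f) = - \<phi> f"
  using hom_add[of "- f" f] by (simp add: hom_zero eq_neg_iff_add_eq_0)

lemma hom_diff: "\<phi> (f - g) = \<phi> f - \<phi> g"
  using hom_add[of f "- g"] by (simp add: hom_minus)

lemma hom_eq_zero_iff: "\<phi> f = 0 \<longleftrightarrow> f = 0"
proof
  assume *: "\<phi> f = 0"
  show "f = 0"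
  proof (rule ccontr)
    assume "f \<noteq> 0"
    then have "\<phi> (f * inverse f) = 1" by (simp add: hom_one)
    then show False using * by (simp add: hom_mult)
  qed
qed (simp add: hom_zero)

lemma hom_divide: "\<phi> (f / g) = \<phi> f / \<phi> g"
proof (cases "g = 0")
  case False
  then have "\<phi> (f / g) * \<phi> g = \<phi> f" by (simp flip: hom_mult)
  then show ?thesis using False by (simp add: hom_eq_zero_iff nonzero_eq_divide_eq)
qed (simp add: hom_zero)

lemma hom_power: "\<phi> (f ^ n) = \<phi> f ^ n"
  by (induction n) (simp_all add: hom_one hom_mult)

lemma hom_numeral: "\<phi> (numeral n) = numeral n"
  by (induction n) (simp_all only: numeral.simps hom_one hom_add)

lemmas hom_simps = hom_add hom_mult hom_const hom_one hom_zero hom_minus hom_diff hom_divide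
  hom_power hom_numeral

end

lemma ratfun_hom_comp: "ratfun_hom \<phi> \<Longrightarrow> ratfun_hom \<psi> \<Longrightarrow> ratfun_hom (\<phi> \<circ> \<psi>)"
  by (simp add: ratfun_hom_def)

lemma ratfun_hom_id: "ratfun_hom id"
  by (simp add: ratfun_hom_def)

lemma ratfun_hom_eqI:
  assumes "ratfun_hom \<phi>" "ratfun_hom \<psi>" "\<forall>v. \<phi> (gen v) = \<psi> (gen v)"
  shows "\<phi> = \<psi>"
proof
  interpret \<phi>: ratfun_hom \<phi> by fact
  interpret \<psi>: ratfun_hom \<psi> by fact
  have poly: "\<phi> (Fract p 1) = \<psi> (Fract p 1)" for p
  proof (induction p rule: mpol_induct)
    case (const c)
    then show ?case by (simp add: \<phi>.hom_const \<psi>.hom_const flip: const_eq)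
  next
    case (var v)
    then show ?case by (simp add: assms(3) flip: gen_eq)
  next
    case (add p q)
    then show ?case using \<phi>.hom_add[of "Fract p 1" "Fract q 1"] \<psi>.hom_add[of "Fract p 1" "Fract q 1"]
      by simp
  next
    case (mult p q)
    then show ?case using \<phi>.hom_mult[of "Fract p 1" "Fract q 1"] \<psi>.hom_mult[of "Fract p 1" "Fract q 1"]
      by simp
  qed
  fix f :: ratfun
  obtain p q where "f = Fract p q" "q \<noteq> 0" by (cases f)
  then have "f = Fract p 1 / Fract q 1" by simp
  then show "\<phi> f = \<psi> f" by (simp only: \<phi>.hom_divide \<psi>.hom_divide poly)
qed

context substitution
begin

sublocale ratfun_hom "subst_ratfun \<tau>"
  by standard (simp_all add: subst_ratfun_def subst_value_const)

lemma subst_gen: "subst_ratfun \<tau> (gen v) = entry \<tau> v"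
  by (simp add: subst_ratfun_def subst_value_gen)

end

lemma inverse_substitutions:
  assumes "left_inverse \<tau>' \<tau>" "left_inverse \<tau> \<tau>'"
  shows "subst_ratfun \<tau>' \<circ> subst_ratfun \<tau> = id"
proof -
  interpret s: substitution \<tau> \<tau>' by standard fact
  interpret s': substitution \<tau>' \<tau> by standard fact
  show ?thesis
    using assms(1)
    by (intro ratfun_hom_eqI ratfun_hom_comp s.ratfun_hom_axioms s'.ratfun_hom_axioms ratfun_hom_id)
      (simp add: s.subst_gen left_inverse_def, simp add: subst_ratfun_def)
qed

lemma field_automorphism_subst:
  assumes "left_inverse \<tau>' \<tau>" "left_inverse \<tau> \<tau>'"
  shows "field_automorphism (subst_ratfun \<tau>)"
proof -
  interpret substitution \<tau> \<tau>' by standard fact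
  have "bij (subst_ratfun \<tau>)"
    using inverse_substitutions[OF assms] inverse_substitutions[OF assms(2,1)] by (rule o_bij)
  then show ?thesis by (simp add: field_automorphism_def hom_add hom_mult hom_const)
qed

section \<open>Values at complex tuples\<close>

interpretation complex_coeff: coefficient_hom "id :: complex \<Rightarrow> complex"
  by standard simp_all

lemma pol_value_eq_eval: "pol_value p c = eval_mpoly id (coord c) p"
  by (simp add: pol_value_def eval_mpoly_def)

interpretation at_point: hom_to_field "\<lambda>p. pol_value p c" for c
  by standard (use complex_coeff.eval_const[of _ 1] in
    \<open>simp_all add: pol_value_eq_eval complex_coeff.eval_add complex_coeff.eval_mult mconst_def\<close>)

lemma regular_at_eq: "regular_at f c = defined_under (\<lambda>p. pol_value p c) f"
  by (simp add: regular_at_def defined_under_def)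

lemma rat_value_eq: "rat_value f c = value_under (\<lambda>p. pol_value p c) f"
  by (simp add: rat_value_def value_under_def)

lemma regular_gen [simp]: "regular_at (gen v) c"
  and rat_value_gen [simp]: "rat_value (gen v) c = coord c v"
  and regular_const [simp]: "regular_at (const a) c"
  and rat_value_const [simp]: "rat_value (const a) c = a"
  by (simp_all add: regular_at_eq rat_value_eq gen_eq const_eq)
    (simp_all add: pol_value_eq_eval complex_coeff.eval_var complex_coeff.eval_const)

lemmas regular_simps [simp] =
  at_point.defined_add[folded regular_at_eq] at_point.defined_mult[folded regular_at_eq]
  at_point.defined_minus[folded regular_at_eq] at_point.defined_diff[folded regular_at_eq]
  at_point.defined_divide[folded regular_at_eq rat_value_eq]
  at_point.defined_one[folded regular_at_eq] at_point.defined_zero[folded regular_at_eq]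
  at_point.defined_numeral[folded regular_at_eq] at_point.defined_power[folded regular_at_eq]

lemmas rat_value_simps [simp] =
  at_point.value_add[folded regular_at_eq rat_value_eq]
  at_point.value_mult[folded regular_at_eq rat_value_eq]
  at_point.value_minus[folded regular_at_eq rat_value_eq]
  at_point.value_diff[folded regular_at_eq rat_value_eq]
  at_point.value_divide[folded regular_at_eq rat_value_eq]
  at_point.value_one[folded rat_value_eq] at_point.value_zero[folded rat_value_eq]
  at_point.value_numeral[folded rat_value_eq]
  at_point.value_power[folded regular_at_eq rat_value_eq]

lemma nonzero_if_value_nonzero: "rat_value f c \<noteq> 0 \<Longrightarrow> f \<noteq> 0"
  by auto

section \<open>The relations\<close>

lemmas tr_defs = tr_s0_def tr_s1_def tr_s2_def tr_s3_def tr_s4_def tr_pi_def generic_def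

text \<open>The simplifier decides definedness of a fraction by the non-vanishing of its denominator, so the
  denominators of the generators are shown to be non-zero once, each by a value at a point.\<close>

lemma gen_nonzero [simp]: "gen v \<noteq> 0"
proof (rule nonzero_if_value_nonzero)
  show "rat_value (gen v) (Conf 1 1 1 1 1 (Params 1 1 1 1 1)) \<noteq> 0"
    by (cases v) simp_all
qed

lemma gen_Y_neq_one [simp]: "gen VY \<noteq> 1"
proof -
  have "gen VY - 1 \<noteq> 0"
    by (rule nonzero_if_value_nonzero[of _ "Conf 0 0 0 0 0 (Params 0 0 0 0 0)"]) simp
  then show ?thesis by simp
qed

lemma s3_denominator_nonzero [simp]: "gen VY + gen VW ^ 2 \<noteq> gen VT"
proof -
  have "gen VY + gen VW ^ 2 - gen VT \<noteq> 0"
    by (rule nonzero_if_value_nonzero[of _ "Conf 0 1 0 0 0 (Params 0 0 0 0 0)"]) simp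
  then show ?thesis by simp
qed

lemma forall_var:
  "(\<forall>v. P v) \<longleftrightarrow> P VX \<and> P VY \<and> P VZ \<and> P VW \<and> P VT \<and> P VA1 \<and> P VA2 \<and> P VA3 \<and> P VA4"
  by (metis var.exhaust)

definition tr_pi_inv :: "ratfun conf" where
  "tr_pi_inv = (case generic of Conf x y z w t (Params a0 a1 a2 a3 a4) \<Rightarrow>
    Conf (- x) (1 - y) (const (- \<i>) * z) (const \<i> * w) (1 - t) (Params a1 a0 a2 a3 a4))"

lemma const_i_square: "const \<i> * const \<i> = -1"
  by (simp flip: const_mult const_minus const_one)

lemma const_i_nonzero [simp]: "const \<i> \<noteq> 0"
  using const_i_square by auto

lemma entries:
  "entry tr_s0 = gen(VX := gen VX + (1 - gen VA1 - 2 * gen VA2 - 2 * gen VA3 - gen VA4) / (gen VY - 1),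
     VA2 := gen VA2 + (1 - gen VA1 - 2 * gen VA2 - 2 * gen VA3 - gen VA4))"
  "entry tr_s1 = gen(VX := gen VX + gen VA1 / gen VY,
     VA1 := - gen VA1,
     VA2 := gen VA2 + gen VA1)"
  "entry tr_s2 = gen(VY := gen VY - gen VA2 / gen VX,
     VA1 := gen VA1 + gen VA2,
     VA2 := - gen VA2,
     VA3 := gen VA3 + gen VA2)"
  "entry tr_s3 = gen(VX := gen VX + gen VA3 / (gen VY + gen VW ^ 2 - gen VT),
     VZ := gen VZ + 2 * gen VA3 * gen VW / (gen VY + gen VW ^ 2 - gen VT),
     VA2 := gen VA2 + gen VA3,
     VA3 := - gen VA3,
     VA4 := gen VA4 + 2 * gen VA3)"
  "entry tr_s4 = gen(VW := gen VW - gen VA4 / gen VZ,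
     VA3 := gen VA3 + gen VA4,
     VA4 := - gen VA4)"
  "entry tr_pi = gen(VX := - gen VX,
     VY := 1 - gen VY,
     VZ := const \<i> * gen VZ,
     VW := gen VW / const \<i>,
     VT := 1 - gen VT,
     VA1 := (1 - gen VA1 - 2 * gen VA2 - 2 * gen VA3 - gen VA4))"
  "entry tr_pi_inv = gen(VX := - gen VX,
     VY := 1 - gen VY,
     VZ := const (- \<i>) * gen VZ,
     VW := const \<i> * gen VW,
     VT := 1 - gen VT,
     VA1 := (1 - gen VA1 - 2 * gen VA2 - 2 * gen VA3 - gen VA4))"
  unfolding fun_eq_iff forall_var by (simp_all add: entry.simps tr_defs tr_pi_inv_def)

lemma involutions:
  "left_inverse tr_s0 tr_s0" "left_inverse tr_s1 tr_s1" "left_inverse tr_s2 tr_s2"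
  "left_inverse tr_s3 tr_s3" "left_inverse tr_s4 tr_s4"
  by (simp_all add: left_inverse_def forall_var subst_value_gen entries flip: add_divide_distrib)

lemma pi_inverse: "left_inverse tr_pi_inv tr_pi" "left_inverse tr_pi tr_pi_inv"
  by (simp_all add: left_inverse_def forall_var subst_value_gen subst_value_const entries const_minus
      const_i_square flip: mult.assoc)

lemma map_generic:
  assumes "ratfun_hom \<phi>"
  shows "map_conf \<phi> generic =
    (let e = (\<lambda>v. \<phi> (gen v)) in Conf (e VX) (e VY) (e VZ) (e VW) (e VT)
      (Params (1 - e VA1 - 2 * e VA2 - 2 * e VA3 - e VA4) (e VA1) (e VA2) (e VA3) (e VA4)))"
proof -
  interpret ratfun_hom \<phi> by fact
  show ?thesis
    by (simp add: generic_def Let_def hom_simps)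
qed

text \<open>The tuple \<open>\<tau>\<close> also records the image of \<open>\<alpha>\<^sub>0\<close>, which is not one of the nine variables. The last
  hypothesis, that \<open>\<tau>\<close> respects the parameter relation, makes it agree with the image that the other
  entries determine.\<close>

lemma induces_subst:
  assumes "left_inverse \<tau>' \<tau>" "left_inverse \<tau> \<tau>'"
    "p0 (cp \<tau>) = 1 - p1 (cp \<tau>) - 2 * p2 (cp \<tau>) - 2 * p3 (cp \<tau>) - p4 (cp \<tau>)"
  shows "induces \<tau> (subst_ratfun \<tau>)"
proof -
  interpret substitution \<tau> \<tau>' by standard fact
  show ?thesis
    unfolding induces_def map_generic[OF ratfun_hom_axioms] Let_def
    using field_automorphism_subst[OF assms(1,2)] assms(3)
    by (simp add: subst_gen entry.simps flip: assms(3))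
qed

lemma induces_generators:
  "induces tr_s0 (subst_ratfun tr_s0)" "induces tr_s1 (subst_ratfun tr_s1)" "induces tr_s2 (subst_ratfun tr_s2)"
  "induces tr_s3 (subst_ratfun tr_s3)" "induces tr_s4 (subst_ratfun tr_s4)"
  "induces tr_pi (subst_ratfun tr_pi)"
  by - (rule induces_subst, rule involutions pi_inverse, rule involutions pi_inverse, simp add: tr_defs algebra_simps)+

lemma order_3_if_braid:
  fixes f g :: "'a \<Rightarrow> 'a"
  assumes "f \<circ> f = id" "g \<circ> g = id" "f \<circ> g \<circ> f = g \<circ> f \<circ> g"
  shows "(f \<circ> g) ^^ 3 = id"
proof -
  have "f (f x) = x" "g (g x) = x" "f (g (f x)) = g (f (g x))" for x
    using assms by (metis comp_apply id_apply)+
  then show ?thesis by (simp add: fun_eq_iff numeral_3_eq_3)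
qed

lemma order_4_if_braid:
  fixes f g :: "'a \<Rightarrow> 'a"
  assumes "f \<circ> f = id" "g \<circ> g = id" "f \<circ> g \<circ> f \<circ> g = g \<circ> f \<circ> g \<circ> f"
  shows "(f \<circ> g) ^^ 4 = id"
proof -
  have "f (f x) = x" "g (g x) = x" "f (g (f (g x))) = g (f (g (f x)))" for x
    using assms by (metis comp_apply id_apply)+
  then show ?thesis by (simp add: fun_eq_iff eval_nat_numeral)
qed

interpretation S0: substitution tr_s0 tr_s0 by standard (rule involutions)
interpretation S1: substitution tr_s1 tr_s1 by standard (rule involutions)
interpretation S2: substitution tr_s2 tr_s2 by standard (rule involutions)
interpretation S3: substitution tr_s3 tr_s3 by standard (rule involutions)
interpretation S4: substitution tr_s4 tr_s4 by standard (rule involutions)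
interpretation P: substitution tr_pi tr_pi_inv by standard (rule pi_inverse)

lemmas subst_generators = S0.subst_gen S1.subst_gen S2.subst_gen S3.subst_gen S4.subst_gen P.subst_gen

lemmas hom_simps = S0.hom_simps S1.hom_simps S2.hom_simps S3.hom_simps S4.hom_simps P.hom_simps

lemmas ratfun_homs = S0.ratfun_hom_axioms S1.ratfun_hom_axioms S2.ratfun_hom_axioms
  S3.ratfun_hom_axioms S4.ratfun_hom_axioms P.ratfun_hom_axioms

lemma commuting_generators:
  "subst_ratfun tr_s0 \<circ> subst_ratfun tr_s1 = subst_ratfun tr_s1 \<circ> subst_ratfun tr_s0"
  "subst_ratfun tr_s0 \<circ> subst_ratfun tr_s3 = subst_ratfun tr_s3 \<circ> subst_ratfun tr_s0"
  "subst_ratfun tr_s0 \<circ> subst_ratfun tr_s4 = subst_ratfun tr_s4 \<circ> subst_ratfun tr_s0"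
  "subst_ratfun tr_s1 \<circ> subst_ratfun tr_s3 = subst_ratfun tr_s3 \<circ> subst_ratfun tr_s1"
  "subst_ratfun tr_s1 \<circ> subst_ratfun tr_s4 = subst_ratfun tr_s4 \<circ> subst_ratfun tr_s1"
  "subst_ratfun tr_s2 \<circ> subst_ratfun tr_s4 = subst_ratfun tr_s4 \<circ> subst_ratfun tr_s2"
  by - (intro ratfun_hom_eqI ratfun_hom_comp ratfun_homs; unfold forall_var comp_apply;
    simp add: subst_generators entries hom_simps algebra_simps)+

lemma pi_conjugation:
  "subst_ratfun tr_pi \<circ> subst_ratfun tr_s0 = subst_ratfun tr_s1 \<circ> subst_ratfun tr_pi"
  "subst_ratfun tr_pi \<circ> subst_ratfun tr_s1 = subst_ratfun tr_s0 \<circ> subst_ratfun tr_pi"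
  "subst_ratfun tr_pi \<circ> subst_ratfun tr_s2 = subst_ratfun tr_s2 \<circ> subst_ratfun tr_pi"
  "subst_ratfun tr_pi \<circ> subst_ratfun tr_s3 = subst_ratfun tr_s3 \<circ> subst_ratfun tr_pi"
  "subst_ratfun tr_pi \<circ> subst_ratfun tr_s4 = subst_ratfun tr_s4 \<circ> subst_ratfun tr_pi"
proof -
  (* The reflection of y and t changes the sign of the denominators y - 1 and y + w^2 - t. *)
  have flip: "r / (1 - gen VY) = - (r / (gen VY - 1))" for r :: ratfun
    by (metis minus_diff_eq minus_divide_right)
  have square: "(gen VW / const \<i>)\<^sup>2 = - (gen VW ^ 2)"
    by (simp add: power2_eq_square const_i_square)
  have "1 - gen VY + - (gen VW ^ 2) - (1 - gen VT) = - (gen VY + gen VW ^ 2 - gen VT)"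
    by simp
  then have flip': "r / (1 - gen VY + - (gen VW ^ 2) - (1 - gen VT)) = - (r / (gen VY + gen VW ^ 2 - gen VT))"
    for r :: ratfun by (simp only: minus_divide_right)
  have i: "r / const \<i> = - (const \<i> * r)" for r :: ratfun
    using const_i_square by (simp add: nonzero_divide_eq_eq mult_ac)
  note rules = subst_generators entries hom_simps fun_upd_apply var.distinct if_False if_True simp_thms
  show "subst_ratfun tr_pi \<circ> subst_ratfun tr_s0 = subst_ratfun tr_s1 \<circ> subst_ratfun tr_pi"
    by (intro ratfun_hom_eqI ratfun_hom_comp ratfun_homs; unfold forall_var comp_apply)
      (simp add: subst_generators entries hom_simps)
  show "subst_ratfun tr_pi \<circ> subst_ratfun tr_s1 = subst_ratfun tr_s0 \<circ> subst_ratfun tr_pi"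
    by (intro ratfun_hom_eqI ratfun_hom_comp ratfun_homs; unfold forall_var comp_apply)
      (simp add: subst_generators entries hom_simps flip)
  show "subst_ratfun tr_pi \<circ> subst_ratfun tr_s2 = subst_ratfun tr_s2 \<circ> subst_ratfun tr_pi"
    by (intro ratfun_hom_eqI ratfun_hom_comp ratfun_homs; unfold forall_var comp_apply)
      (simp add: subst_generators entries hom_simps)
  show "subst_ratfun tr_pi \<circ> subst_ratfun tr_s3 = subst_ratfun tr_s3 \<circ> subst_ratfun tr_pi"
    by (intro ratfun_hom_eqI ratfun_hom_comp ratfun_homs; unfold forall_var comp_apply)
      (simp only: rules square flip'; simp add: i algebra_simps)
  show "subst_ratfun tr_pi \<circ> subst_ratfun tr_s4 = subst_ratfun tr_s4 \<circ> subst_ratfun tr_pi"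
    by (intro ratfun_hom_eqI ratfun_hom_comp ratfun_homs; unfold forall_var comp_apply)
      (simp add: subst_generators entries hom_simps diff_divide_distrib mult_ac)
qed

text \<open>The identity behind \<open>s\<^sub>i s\<^sub>2 s\<^sub>i = s\<^sub>2 s\<^sub>i s\<^sub>2\<close>: both sides are \<open>(a + b) x / (x u - b)\<close>, as
  the nested denominator on the left is \<open>u (x u - b) / (x u + a)\<close>.\<close>

lemma braid_identity:
  fixes x u a b :: "'a::field"
  assumes "u \<noteq> 0" "x \<noteq> 0" "x + a / u \<noteq> 0" "u - b / x \<noteq> 0"
  shows "a / u + b / (u - (b + a) / (x + a / u)) = (a + b) / (u - b / x)"
proof -
  have *: "x * u + a \<noteq> 0" "x * u - b \<noteq> 0"
    using assms by (auto simp: field_simps)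
  have "u - (b + a) / (x + a / u) = u * (x * u - b) / (x * u + a)"
    using assms(1) * by (simp add: divide_simps) (simp add: algebra_simps)
  moreover have "u - b / x = (x * u - b) / x"
    using assms(2) by (simp add: field_simps)
  ultimately show ?thesis
    using assms(1,2) * by (simp add: divide_simps) (simp add: algebra_simps)
qed

text \<open>Here \<open>\<phi>\<close> stands for \<open>s\<^sub>0\<close>, \<open>s\<^sub>1\<close> or \<open>s\<^sub>3\<close> with denominator \<open>u\<close> and parameter \<open>a\<close>, and \<open>\<psi>\<close>
  for \<open>s\<^sub>2\<close> with parameter \<open>b\<close>. The element \<open>z\<close> is any coordinate that \<open>\<phi>\<close> shifts and
  \<open>\<psi>\<close> fixes; the factor \<open>k\<close> covers both \<open>x\<close>, with \<open>k = 1\<close>, and the coordinate \<open>z\<close> under \<open>s\<^sub>3\<close>,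
  with \<open>k = 2 w\<close>.\<close>

lemma braid_on_shifted:
  assumes "ratfun_hom \<phi>" "ratfun_hom \<psi>"
    and \<phi>: "\<phi> x = x + a / u" "\<phi> u = u" "\<phi> a = - a" "\<phi> b = b + a"
    and \<psi>: "\<psi> x = x" "\<psi> u = u - b / x" "\<psi> a = a + b" "\<psi> b = - b"
    and nonzero: "x \<noteq> 0" "u \<noteq> 0"
    and z: "\<phi> z = z + k * (a / u)" "\<psi> z = z" "\<phi> k = k" "\<psi> k = k"
  shows "\<phi> (\<psi> (\<phi> z)) = \<psi> (\<phi> (\<psi> z))"
proof -
  interpret \<phi>: ratfun_hom \<phi> by fact
  interpret \<psi>: ratfun_hom \<psi> by fact
  have "x + a / u \<noteq> 0" "u - b / x \<noteq> 0"
    using \<phi>.hom_eq_zero_iff[of x] \<psi>.hom_eq_zero_iff[of u] nonzero \<phi> \<psi> by simp_all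
  note I = braid_identity[OF nonzero(2,1) this]
  have "\<phi> (\<psi> (\<phi> z)) = z + k * (a / u + b / (u - (b + a) / (x + a / u)))"
    by (simp add: z \<phi> \<psi> \<phi>.hom_simps \<psi>.hom_simps algebra_simps)
  also have "\<dots> = \<psi> (\<phi> (\<psi> z))"
    unfolding I by (simp add: z \<phi> \<psi> \<phi>.hom_simps \<psi>.hom_simps)
  finally show ?thesis .
qed

text \<open>The configuration is symmetric under exchanging \<open>\<phi>\<close> with \<open>\<psi>\<close> and \<open>(x, u)\<close> with \<open>(u, - x)\<close>, a canonical
  change of variables, so this is the previous lemma with the roles exchanged.\<close>

lemma braid_on_denominator:
  assumes "ratfun_hom \<phi>" "ratfun_hom \<psi>"
    and \<phi>: "\<phi> x = x + a / u" "\<phi> u = u" "\<phi> a = - a" "\<phi> b = b + a"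
    and \<psi>: "\<psi> x = x" "\<psi> u = u - b / x" "\<psi> a = a + b" "\<psi> b = - b"
    and nonzero: "x \<noteq> 0" "u \<noteq> 0"
  shows "\<phi> (\<psi> (\<phi> u)) = \<psi> (\<phi> (\<psi> u))"
proof -
  interpret \<phi>: ratfun_hom \<phi> by fact
  interpret \<psi>: ratfun_hom \<psi> by fact
  show ?thesis
    by (rule braid_on_shifted[of \<psi> \<phi> u b "- x" a u "1", symmetric])
      (use assms in \<open>simp_all add: \<phi>.hom_simps \<psi>.hom_simps\<close>)
qed

lemma braid_s0_s2:
  "subst_ratfun tr_s0 \<circ> subst_ratfun tr_s2 \<circ> subst_ratfun tr_s0 =
   subst_ratfun tr_s2 \<circ> subst_ratfun tr_s0 \<circ> subst_ratfun tr_s2"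
proof (intro ratfun_hom_eqI ratfun_hom_comp ratfun_homs, unfold forall_var comp_apply, intro conjI)
  let ?S0 = "subst_ratfun tr_s0" and ?S2 = "subst_ratfun tr_s2"
  let ?a0 = "1 - gen VA1 - 2 * gen VA2 - 2 * gen VA3 - gen VA4"
  show "?S0 (?S2 (?S0 (gen VX))) = ?S2 (?S0 (?S2 (gen VX)))"
    by (rule braid_on_shifted[where x = "gen VX" and u = "gen VY - 1" and a = ?a0 and b = "gen VA2" and k = 1])
      (simp_all add: ratfun_homs subst_generators entries hom_simps)
  (* The braid lemma applies to the denominator, which differs from y by a constant. *)
  have "?S0 (?S2 (?S0 (gen VY - 1))) = ?S2 (?S0 (?S2 (gen VY - 1)))"
    by (rule braid_on_denominator[where x = "gen VX" and a = ?a0 and b = "gen VA2"])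
      (simp_all add: ratfun_homs subst_generators entries hom_simps)
  then show "?S0 (?S2 (?S0 (gen VY))) = ?S2 (?S0 (?S2 (gen VY)))"
    by (simp add: hom_simps)
qed (simp_all add: subst_generators entries hom_simps)

lemma braid_s1_s2:
  "subst_ratfun tr_s1 \<circ> subst_ratfun tr_s2 \<circ> subst_ratfun tr_s1 =
   subst_ratfun tr_s2 \<circ> subst_ratfun tr_s1 \<circ> subst_ratfun tr_s2"
proof (intro ratfun_hom_eqI ratfun_hom_comp ratfun_homs, unfold forall_var comp_apply, intro conjI)
  let ?S1 = "subst_ratfun tr_s1" and ?S2 = "subst_ratfun tr_s2"
  show "?S1 (?S2 (?S1 (gen VX))) = ?S2 (?S1 (?S2 (gen VX)))"
    by (rule braid_on_shifted[where x = "gen VX" and u = "gen VY" and a = "gen VA1" and b = "gen VA2" and k = 1])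
      (simp_all add: ratfun_homs subst_generators entries hom_simps)
  show "?S1 (?S2 (?S1 (gen VY))) = ?S2 (?S1 (?S2 (gen VY)))"
    by (rule braid_on_denominator[where x = "gen VX" and a = "gen VA1" and b = "gen VA2"])
      (simp_all add: ratfun_homs subst_generators entries hom_simps)
qed (simp_all add: subst_generators entries hom_simps)

lemma braid_s3_s2:
  "subst_ratfun tr_s3 \<circ> subst_ratfun tr_s2 \<circ> subst_ratfun tr_s3 =
   subst_ratfun tr_s2 \<circ> subst_ratfun tr_s3 \<circ> subst_ratfun tr_s2"
proof (intro ratfun_hom_eqI ratfun_hom_comp ratfun_homs, unfold forall_var comp_apply, intro conjI)
  let ?S3 = "subst_ratfun tr_s3" and ?S2 = "subst_ratfun tr_s2"
  let ?f = "gen VY + gen VW ^ 2 - gen VT"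
  show "?S3 (?S2 (?S3 (gen VX))) = ?S2 (?S3 (?S2 (gen VX)))"
    by (rule braid_on_shifted[where x = "gen VX" and u = ?f and a = "gen VA3" and b = "gen VA2" and k = 1])
      (simp_all add: ratfun_homs subst_generators entries hom_simps)
  show "?S3 (?S2 (?S3 (gen VZ))) = ?S2 (?S3 (?S2 (gen VZ)))"
    by (rule braid_on_shifted[where x = "gen VX" and u = ?f and a = "gen VA3" and b = "gen VA2"
          and k = "2 * gen VW"])
      (simp_all add: ratfun_homs subst_generators entries hom_simps mult_ac)
  (* The denominator differs from y by an element that both maps fix. *)
  have "?S3 (?S2 (?S3 ?f)) = ?S2 (?S3 (?S2 ?f))"
    by (rule braid_on_denominator[where x = "gen VX" and a = "gen VA3" and b = "gen VA2"])
      (simp_all add: ratfun_homs subst_generators entries hom_simps)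
  then show "?S3 (?S2 (?S3 (gen VY))) = ?S2 (?S3 (?S2 (gen VY)))"
    by (simp add: hom_simps) (simp add: subst_generators entries hom_simps)
qed (simp_all add: subst_generators entries hom_simps)

text \<open>With \<open>c = b + 2a\<close>, \<open>M = f z + 2 a w\<close>, \<open>K = z M - b c\<close> and \<open>Q = M\<^sup>2 - 2 w c M + f c\<^sup>2\<close>, the
  homomorphism \<open>\<psi>\<close> fixes \<open>Q\<close> and \<open>c\<close> and sends \<open>M\<close> to \<open>K / z\<close> and \<open>K\<close> to \<open>z M\<close>, while
  \<open>\<phi>\<close> fixes \<open>K\<close> and exchanges \<open>b\<close> with \<open>c\<close>. Three of the four factors turn a coordinate into
  \<^item> \<open>w - (b + c)(f z - b w) / K\<close>, from \<open>w\<close> under \<open>\<psi> \<phi> \<psi>\<close>, which \<open>\<phi>\<close> fixes,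
  \<^item> \<open>K M / Q\<close>, from \<open>z\<close> under \<open>\<phi> \<psi> \<phi>\<close>, which \<open>\<psi>\<close> fixes,
  \<^item> \<open>x + c (z M + a c) / Q\<close>, from \<open>x\<close> under \<open>\<phi> \<psi> \<phi>\<close>, which \<open>\<psi>\<close> fixes.

  Since \<open>\<phi>\<close> fixes \<open>w\<close> and \<open>\<psi>\<close> fixes \<open>x\<close> and \<open>z\<close>, these invariances are the relation.\<close>

lemma square_relation_s3_s4:
  fixes x y z w t a b :: ratfun
  defines "f \<equiv> y + w\<^sup>2 - t"
  assumes "ratfun_hom \<phi>" "ratfun_hom \<psi>"
    and \<phi>: "\<phi> x = x + a / f" "\<phi> y = y" "\<phi> z = z + 2 * a * w / f" "\<phi> w = w" "\<phi> t = t"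
      "\<phi> a = - a" "\<phi> b = b + 2 * a"
    and \<psi>: "\<psi> x = x" "\<psi> y = y" "\<psi> z = z" "\<psi> w = w - b / z" "\<psi> t = t"
      "\<psi> a = a + b" "\<psi> b = - b"
    and nonzero: "z \<noteq> 0" "f \<noteq> 0"
  shows "\<phi> (\<psi> (\<phi> (\<psi> w))) = \<psi> (\<phi> (\<psi> (\<phi> w)))"
    and "\<phi> (\<psi> (\<phi> (\<psi> z))) = \<psi> (\<phi> (\<psi> (\<phi> z)))"
    and "\<phi> (\<psi> (\<phi> (\<psi> x))) = \<psi> (\<phi> (\<psi> (\<phi> x)))"
proof -
  interpret \<phi>: ratfun_hom \<phi> by fact
  interpret \<psi>: ratfun_hom \<psi> by fact
  define c where "c = b + 2 * a"
  define M where "M = f * z + 2 * a * w"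
  define K where "K = z * M - b * c"
  define Q where "Q = M\<^sup>2 - 2 * w * c * M + f * c\<^sup>2"
  define F where "F = f - 2 * w * b / z + b\<^sup>2 / z\<^sup>2"
  have \<phi>f: "\<phi> f = f"
    by (simp add: f_def \<phi> \<phi>.hom_simps)
  have \<psi>f: "\<psi> f = F"
    using nonzero(1)
    by (simp add: F_def f_def \<psi> \<psi>.hom_simps) (simp add: field_simps power2_eq_square)
  have \<phi>z: "\<phi> z = M / f"
    using nonzero by (simp add: \<phi> M_def field_simps)
  have M: "M \<noteq> 0"
    using \<phi>.hom_eq_zero_iff[of z] nonzero by (auto simp: \<phi>z)
  have \<phi>M: "\<phi> M = f * z"
    using nonzero by (simp add: M_def \<phi>.hom_simps \<phi>f \<phi> algebra_simps)
  have c: "\<phi> c = b" "\<psi> c = c" "\<phi> b = c"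
    by (simp_all add: c_def \<phi>.hom_simps \<psi>.hom_simps \<phi> \<psi>)
  have F: "F \<noteq> 0"
    using \<psi>.hom_eq_zero_iff[of f] nonzero by (simp add: \<psi>f)
  have \<psi>M: "\<psi> M = K / z"
  proof -
    have "\<psi> M = F * z + 2 * (a + b) * (w - b / z)"
      by (simp add: M_def \<psi>.hom_simps \<psi>f \<psi>)
    also have "\<dots> = (z * (F * z) + 2 * (a + b) * (w * z - b)) / z"
      using nonzero(1) by (simp add: field_simps)
    also have "z * (F * z) = f * z\<^sup>2 - 2 * w * b * z + b\<^sup>2"
      using nonzero(1) by (simp add: F_def field_simps power2_eq_square)
    also have "\<dots> + 2 * (a + b) * (w * z - b) = K"
      by (simp add: K_def M_def c_def algebra_simps power2_eq_square)
    finally show ?thesis .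
  qed
  then have K: "K \<noteq> 0"
    using \<psi>.hom_eq_zero_iff[of M] M by auto
  have \<psi>K: "\<psi> K = z * M"
    using nonzero(1) by (simp add: K_def \<psi>.hom_simps \<psi>M c \<psi>)
  have \<phi>K: "\<phi> K = K"
    using nonzero(2) by (simp add: K_def \<phi>.hom_simps \<phi>M \<phi>z c mult_ac)
  have \<phi>F: "\<phi> F = f * Q / M\<^sup>2"
    using nonzero(2) M by (simp add: F_def \<phi>.hom_simps \<phi>f \<phi>z c \<phi>(4))
      (simp add: Q_def field_simps power2_eq_square)
  then have Q: "Q \<noteq> 0"
    using \<phi>.hom_eq_zero_iff[of F] F by auto
  have \<psi>Q: "\<psi> Q = Q"
  proof -
    have "\<psi> Q = (K / z)\<^sup>2 - 2 * (w - b / z) * c * (K / z) + F * c\<^sup>2"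
      by (simp add: Q_def \<psi>.hom_simps \<psi>M \<psi>f c \<psi>)
    also have "\<dots> = Q"
      using nonzero(1)
      by (simp add: Q_def K_def F_def field_simps power2_eq_square)
    finally show ?thesis .
  qed

  have "\<psi> (\<phi> (\<psi> w)) = w - (b + c) * (f * z - b * w) / K"
  proof -
    have "\<phi> (\<psi> w) = w - c * f / M"
      by (simp add: \<psi> \<phi>.hom_simps \<phi>z c \<phi>(4))
    then have "\<psi> (\<phi> (\<psi> w)) = w - (c * F / (K / z) + b / z)"
      by (simp add: \<psi>.hom_simps c \<psi>f \<psi>M \<psi>(4))
    also have "c * F / (K / z) + b / z = (c * (z\<^sup>2 * F) + b * K) / (z * K)"
      using nonzero(1) K by (simp add: divide_simps) (simp add: power2_eq_square)
    also have "z\<^sup>2 * F = f * z\<^sup>2 - 2 * w * b * z + b\<^sup>2"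
      using nonzero(1) by (simp add: F_def field_simps power2_eq_square)
    also have "c * \<dots> + b * K = z * ((b + c) * (f * z - b * w))"
      by (simp add: K_def M_def c_def algebra_simps power2_eq_square)
    finally show ?thesis
      using nonzero(1) by simp
  qed
  moreover have "\<phi> (f * z - b * w) = f * z - b * w"
    using nonzero(2) by (simp add: \<phi>.hom_simps \<phi>f \<phi> algebra_simps)
  ultimately show "\<phi> (\<psi> (\<phi> (\<psi> w))) = \<psi> (\<phi> (\<psi> (\<phi> w)))"
    by (simp add: \<phi>.hom_diff[of w] \<phi>.hom_divide \<phi>.hom_mult[of "b + c"] \<phi>.hom_add c \<phi>K \<phi>(4) add.commute)

  have "\<phi> (\<psi> (\<phi> z)) = K * M / Q"
    using nonzero(2) M by (simp add: \<phi>z \<psi>.hom_simps \<psi>M \<psi>f \<phi>.hom_simps \<phi>K \<phi>F power2_eq_square)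
  then show "\<phi> (\<psi> (\<phi> (\<psi> z))) = \<psi> (\<phi> (\<psi> (\<phi> z)))"
    using nonzero(1) by (simp add: \<psi>(3) \<psi>.hom_simps \<psi>K \<psi>M \<psi>Q mult_ac)

  have "\<phi> (\<psi> (\<phi> x)) = x + c * (z * M + a * c) / Q"
  proof -
    have "\<phi> (\<psi> (\<phi> x)) = x + a / f + (a + b) * M\<^sup>2 / (f * Q)"
      by (simp add: \<phi> \<psi>.hom_simps \<psi>f \<phi>.hom_simps \<phi>F \<psi>)
    also have "\<dots> = x + (a * Q + (a + b) * M\<^sup>2) / (f * Q)"
      using nonzero(2) Q by (simp add: field_simps)
    also have "a * Q + (a + b) * M\<^sup>2 = f * (c * (z * M + a * c))"
      by (simp add: Q_def M_def c_def algebra_simps power2_eq_square)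
    finally show ?thesis
      using nonzero(2) by simp
  qed
  moreover have "\<psi> (z * M + a * c) = z * M + a * c"
    using nonzero(1) by (simp add: \<psi>.hom_simps \<psi>M c \<psi>) (simp add: K_def field_simps)
  ultimately show "\<phi> (\<psi> (\<phi> (\<psi> x))) = \<psi> (\<phi> (\<psi> (\<phi> x)))"
    by (simp add: \<psi>(1) \<psi>.hom_add[of x] \<psi>.hom_divide \<psi>.hom_mult[of c] \<psi>Q c)
qed

lemma braid_s3_s4:
  "subst_ratfun tr_s3 \<circ> subst_ratfun tr_s4 \<circ> subst_ratfun tr_s3 \<circ> subst_ratfun tr_s4 =
   subst_ratfun tr_s4 \<circ> subst_ratfun tr_s3 \<circ> subst_ratfun tr_s4 \<circ> subst_ratfun tr_s3"
proof (intro ratfun_hom_eqI ratfun_hom_comp ratfun_homs, unfold forall_var comp_apply, intro conjI)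
  let ?S3 = "subst_ratfun tr_s3" and ?S4 = "subst_ratfun tr_s4"
  note square = square_relation_s3_s4[of ?S3 ?S4
      "gen VX" "gen VA3" "gen VY" "gen VW" "gen VT" "gen VZ" "gen VA4"]
  show "?S3 (?S4 (?S3 (?S4 (gen VX)))) = ?S4 (?S3 (?S4 (?S3 (gen VX))))"
    "?S3 (?S4 (?S3 (?S4 (gen VZ)))) = ?S4 (?S3 (?S4 (?S3 (gen VZ))))"
    "?S3 (?S4 (?S3 (?S4 (gen VW)))) = ?S4 (?S3 (?S4 (?S3 (gen VW))))"
    by (rule square; simp add: ratfun_homs subst_generators entries hom_simps)+
qed (simp_all add: subst_generators entries hom_simps)

section \<open>The Hamiltonian vector field\<close>

text \<open>Numerators of the partial derivatives of the Hamiltonian, that is, the partial derivatives of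
  \<open>t (t - 1) H\<close>. Keeping the factor \<open>t (t - 1)\<close> apart leaves polynomials.\<close>

fun ham_x :: "complex params \<Rightarrow> complex \<Rightarrow> complex \<Rightarrow> complex \<Rightarrow> complex \<Rightarrow> complex \<Rightarrow> complex" where
  "ham_x (Params a0 a1 a2 a3 a4) t x y z w =
    2 * x * y^3 - (2 * (t + 1) * x + 2 * a2 + a3 + a4) * y^2
    + (2 * t * x + (a0 + 2 * a2 + a3 + a4 - (a0 + a1) * t)) * y + a1 * t + y * (y - 1) * z * w"

fun ham_y :: "complex params \<Rightarrow> complex \<Rightarrow> complex \<Rightarrow> complex \<Rightarrow> complex \<Rightarrow> complex \<Rightarrow> complex" where
  "ham_y (Params a0 a1 a2 a3 a4) t x y z w =
    3 * x^2 * y^2 - 2 * ((t + 1) * x + 2 * a2 + a3 + a4) * x * y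
    + (t * x^2 + (a0 + 2 * a2 + a3 + a4 - (a0 + a1) * t) * x + a2 * (a2 + a3 + a4))
    + ((2 * y - 1) * x - a2) * z * w"

fun ham_z :: "complex params \<Rightarrow> complex \<Rightarrow> complex \<Rightarrow> complex \<Rightarrow> complex \<Rightarrow> complex \<Rightarrow> complex" where
  "ham_z (Params a0 a1 a2 a3 a4) t x y z w =
    (- (z * w^4) + a4 * w^3 + (2 * t - 1) * z * w^2
      - (- a0 - 2 * a2 - a3 - a4 + (a4 + 1) * t) * w - t * (t - 1) * z) / 2
    + y * ((y - 1) * x - a2) * w"

fun ham_w :: "complex params \<Rightarrow> complex \<Rightarrow> complex \<Rightarrow> complex \<Rightarrow> complex \<Rightarrow> complex \<Rightarrow> complex" where
  "ham_w (Params a0 a1 a2 a3 a4) t x y z w =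
    (- 2 * z^2 * w^3 + 3 * a4 * z * w^2 + ((2 * t - 1) * z^2 - a4^2) * w
      - (- a0 - 2 * a2 - a3 - a4 + (a4 + 1) * t) * z) / 2
    + y * ((y - 1) * x - a2) * z"

lemma ham_partial_derivatives:
  "deriv (\<lambda>u. ham a t u y z w) x = ham_x a t x y z w / (t * (t - 1))"
  "deriv (\<lambda>v. ham a t x v z w) y = ham_y a t x y z w / (t * (t - 1))"
  "deriv (\<lambda>u. ham a t x y u w) z = ham_z a t x y z w / (t * (t - 1))"
  "deriv (\<lambda>v. ham a t x y z v) w = ham_w a t x y z w / (t * (t - 1))"
proof -
  obtain a0 a1 a2 a3 a4 where a: "a = Params a0 a1 a2 a3 a4" by (cases a)
  note expand = a ham.simps ham_x.simps ham_y.simps ham_z.simps ham_w.simps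
  note derivative = derivative_eq_intros refl
  note power = power2_eq_square power3_eq_cube power4_eq_xxxx
  show "deriv (\<lambda>u. ham a t u y z w) x = ham_x a t x y z w / (t * (t - 1))"
    unfolding expand
    by (intro DERIV_imp_deriv DERIV_cdivide) (rule derivative | simp add: algebra_simps power)+
  show "deriv (\<lambda>v. ham a t x v z w) y = ham_y a t x y z w / (t * (t - 1))"
    unfolding expand
    by (intro DERIV_imp_deriv DERIV_cdivide) (rule derivative | simp add: algebra_simps power)+
  show "deriv (\<lambda>u. ham a t x y u w) z = ham_z a t x y z w / (t * (t - 1))"
    unfolding expand
    by (intro DERIV_imp_deriv DERIV_cdivide) (rule derivative | simp add: field_simps power)+
  show "deriv (\<lambda>v. ham a t x y z v) w = ham_w a t x y z w / (t * (t - 1))"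
    unfolding expand
    by (intro DERIV_imp_deriv DERIV_cdivide) (rule derivative | simp add: field_simps power)+
qed

text \<open>The differential equations at a single time. The transformations that fix \<open>t\<close> are verified
  pointwise, without reference to the domain of the solution.\<close>

definition system_at ::
    "complex params \<Rightarrow> (complex \<Rightarrow> complex) \<Rightarrow> (complex \<Rightarrow> complex) \<Rightarrow>
      (complex \<Rightarrow> complex) \<Rightarrow> (complex \<Rightarrow> complex) \<Rightarrow> complex \<Rightarrow> bool" where
  "system_at a x y z w t \<longleftrightarrow>
    (x has_field_derivative ham_y a t (x t) (y t) (z t) (w t) / (t * (t - 1))) (at t) \<and>
    (y has_field_derivative - ham_x a t (x t) (y t) (z t) (w t) / (t * (t - 1))) (at t) \<and>
    (z has_field_derivative ham_w a t (x t) (y t) (z t) (w t) / (t * (t - 1))) (at t) \<and>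
    (w has_field_derivative - ham_z a t (x t) (y t) (z t) (w t) / (t * (t - 1))) (at t)"

lemma system_atD:
  assumes "system_at a x y z w t"
  shows "(x has_field_derivative ham_y a t (x t) (y t) (z t) (w t) / (t * (t - 1))) (at t)"
    and "(y has_field_derivative - ham_x a t (x t) (y t) (z t) (w t) / (t * (t - 1))) (at t)"
    and "(z has_field_derivative ham_w a t (x t) (y t) (z t) (w t) / (t * (t - 1))) (at t)"
    and "(w has_field_derivative - ham_z a t (x t) (y t) (z t) (w t) / (t * (t - 1))) (at t)"
  using assms by (simp_all add: system_at_def)

lemma solution_iff:
  "solution a D x y z w \<longleftrightarrow>
    param_rel a \<and> open D \<and> 0 \<notin> D \<and> 1 \<notin> D \<and> (\<forall>t\<in>D. system_at a x y z w t)"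
  by (simp add: solution_def system_at_def ham_partial_derivatives)

lemmas expand_ring = algebra_simps add_divide_distrib diff_divide_distrib
  power2_eq_square power3_eq_cube power4_eq_xxxx

text \<open>The first identity says that the derivative of \<open>r = a0 / (y - 1)\<close> along the flow is the difference of
  the two velocities of \<open>x\<close>; the factor \<open>y - 1\<close> is its cleared denominator. The other three say that the
  remaining components of the vector field do not see the transformation. The parameter relation is
  used to eliminate \<open>a1\<close>, so that both sides become polynomials in independent variables. The
  analogues for \<open>s\<^sub>1\<close>, \<open>s\<^sub>2\<close> and \<open>s\<^sub>4\<close> have the same structure.\<close>

lemma s0_vector_field:
  assumes "a0 + a1 + 2 * a2 + 2 * a3 + a4 = 1" "a0 = r * (y - 1)"
  shows "r * ham_x (Params a0 a1 a2 a3 a4) t x y z w =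
      (y - 1) * (ham_y (Params (- a0) a1 (a2 + a0) a3 a4) t (x + r) y z w
          - ham_y (Params a0 a1 a2 a3 a4) t x y z w)"
    and "ham_x (Params (- a0) a1 (a2 + a0) a3 a4) t (x + r) y z w =
        ham_x (Params a0 a1 a2 a3 a4) t x y z w"
    and "ham_z (Params (- a0) a1 (a2 + a0) a3 a4) t (x + r) y z w =
        ham_z (Params a0 a1 a2 a3 a4) t x y z w"
    and "ham_w (Params (- a0) a1 (a2 + a0) a3 a4) t (x + r) y z w =
        ham_w (Params a0 a1 a2 a3 a4) t x y z w"
proof -
  have relation: "a1 = 1 - a0 - 2 * a2 - 2 * a3 - a4"
    using assms(1) by (simp add: algebra_simps)
  note expand = ham_x.simps ham_y.simps ham_z.simps ham_w.simps relation assms(2)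
  show "r * ham_x (Params a0 a1 a2 a3 a4) t x y z w =
      (y - 1) * (ham_y (Params (- a0) a1 (a2 + a0) a3 a4) t (x + r) y z w
          - ham_y (Params a0 a1 a2 a3 a4) t x y z w)"
    unfolding expand by (simp add: expand_ring)
  show "ham_x (Params (- a0) a1 (a2 + a0) a3 a4) t (x + r) y z w =
      ham_x (Params a0 a1 a2 a3 a4) t x y z w"
    unfolding expand by (simp add: expand_ring)
  show "ham_z (Params (- a0) a1 (a2 + a0) a3 a4) t (x + r) y z w =
      ham_z (Params a0 a1 a2 a3 a4) t x y z w"
    unfolding expand by (simp add: expand_ring)
  show "ham_w (Params (- a0) a1 (a2 + a0) a3 a4) t (x + r) y z w =
      ham_w (Params a0 a1 a2 a3 a4) t x y z w"
    unfolding expand by (simp add: expand_ring)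
qed

lemma s1_vector_field:
  assumes "a0 + a1 + 2 * a2 + 2 * a3 + a4 = 1" "a1 = r * y"
  shows "r * ham_x (Params a0 a1 a2 a3 a4) t x y z w =
      y * (ham_y (Params a0 (- a1) (a2 + a1) a3 a4) t (x + r) y z w
          - ham_y (Params a0 a1 a2 a3 a4) t x y z w)"
    and "ham_x (Params a0 (- a1) (a2 + a1) a3 a4) t (x + r) y z w =
        ham_x (Params a0 a1 a2 a3 a4) t x y z w"
    and "ham_z (Params a0 (- a1) (a2 + a1) a3 a4) t (x + r) y z w =
        ham_z (Params a0 a1 a2 a3 a4) t x y z w"
    and "ham_w (Params a0 (- a1) (a2 + a1) a3 a4) t (x + r) y z w =
        ham_w (Params a0 a1 a2 a3 a4) t x y z w"
proof -
  have relation: "a0 = 1 - a1 - 2 * a2 - 2 * a3 - a4"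
    using assms(1) by (simp add: algebra_simps)
  note expand = ham_x.simps ham_y.simps ham_z.simps ham_w.simps relation assms(2)
  show "r * ham_x (Params a0 a1 a2 a3 a4) t x y z w =
      y * (ham_y (Params a0 (- a1) (a2 + a1) a3 a4) t (x + r) y z w
          - ham_y (Params a0 a1 a2 a3 a4) t x y z w)"
    unfolding expand by (simp add: expand_ring)
  show "ham_x (Params a0 (- a1) (a2 + a1) a3 a4) t (x + r) y z w =
      ham_x (Params a0 a1 a2 a3 a4) t x y z w"
    unfolding expand by (simp add: expand_ring)
  show "ham_z (Params a0 (- a1) (a2 + a1) a3 a4) t (x + r) y z w =
      ham_z (Params a0 a1 a2 a3 a4) t x y z w"
    unfolding expand by (simp add: expand_ring)
  show "ham_w (Params a0 (- a1) (a2 + a1) a3 a4) t (x + r) y z w =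
      ham_w (Params a0 a1 a2 a3 a4) t x y z w"
    unfolding expand by (simp add: expand_ring)
qed

lemma s2_vector_field:
  assumes "a0 + a1 + 2 * a2 + 2 * a3 + a4 = 1" "a2 = r * x"
  shows "r * ham_y (Params a0 a1 a2 a3 a4) t x y z w =
      x * (ham_x (Params a0 a1 a2 a3 a4) t x y z w
          - ham_x (Params (a0 + a2) (a1 + a2) (- a2) (a3 + a2) a4) t x (y - r) z w)"
    and "ham_y (Params (a0 + a2) (a1 + a2) (- a2) (a3 + a2) a4) t x (y - r) z w =
        ham_y (Params a0 a1 a2 a3 a4) t x y z w"
    and "ham_z (Params (a0 + a2) (a1 + a2) (- a2) (a3 + a2) a4) t x (y - r) z w =
        ham_z (Params a0 a1 a2 a3 a4) t x y z w"
    and "ham_w (Params (a0 + a2) (a1 + a2) (- a2) (a3 + a2) a4) t x (y - r) z w =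
        ham_w (Params a0 a1 a2 a3 a4) t x y z w"
proof -
  have relation: "a0 = 1 - a1 - 2 * a2 - 2 * a3 - a4"
    using assms(1) by (simp add: algebra_simps)
  note expand = ham_x.simps ham_y.simps ham_z.simps ham_w.simps relation assms(2)
  show "r * ham_y (Params a0 a1 a2 a3 a4) t x y z w =
      x * (ham_x (Params a0 a1 a2 a3 a4) t x y z w
          - ham_x (Params (a0 + a2) (a1 + a2) (- a2) (a3 + a2) a4) t x (y - r) z w)"
    unfolding expand by (simp add: expand_ring)
  show "ham_y (Params (a0 + a2) (a1 + a2) (- a2) (a3 + a2) a4) t x (y - r) z w =
      ham_y (Params a0 a1 a2 a3 a4) t x y z w"
    unfolding expand by (simp add: expand_ring)
  show "ham_z (Params (a0 + a2) (a1 + a2) (- a2) (a3 + a2) a4) t x (y - r) z w =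
      ham_z (Params a0 a1 a2 a3 a4) t x y z w"
    unfolding expand by (simp add: expand_ring)
  show "ham_w (Params (a0 + a2) (a1 + a2) (- a2) (a3 + a2) a4) t x (y - r) z w =
      ham_w (Params a0 a1 a2 a3 a4) t x y z w"
    unfolding expand by (simp add: expand_ring)
qed

lemma s4_vector_field:
  assumes "a0 + a1 + 2 * a2 + 2 * a3 + a4 = 1" "a4 = r * z"
  shows "r * ham_w (Params a0 a1 a2 a3 a4) t x y z w =
      z * (ham_z (Params a0 a1 a2 a3 a4) t x y z w
          - ham_z (Params a0 a1 a2 (a3 + a4) (- a4)) t x y z (w - r))"
    and "ham_x (Params a0 a1 a2 (a3 + a4) (- a4)) t x y z (w - r) =
        ham_x (Params a0 a1 a2 a3 a4) t x y z w"
    and "ham_y (Params a0 a1 a2 (a3 + a4) (- a4)) t x y z (w - r) =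
        ham_y (Params a0 a1 a2 a3 a4) t x y z w"
    and "ham_w (Params a0 a1 a2 (a3 + a4) (- a4)) t x y z (w - r) =
        ham_w (Params a0 a1 a2 a3 a4) t x y z w"
proof -
  have relation: "a0 = 1 - a1 - 2 * a2 - 2 * a3 - a4"
    using assms(1) by (simp add: algebra_simps)
  note expand = ham_x.simps ham_y.simps ham_z.simps ham_w.simps relation assms(2)
  show "r * ham_w (Params a0 a1 a2 a3 a4) t x y z w =
      z * (ham_z (Params a0 a1 a2 a3 a4) t x y z w
          - ham_z (Params a0 a1 a2 (a3 + a4) (- a4)) t x y z (w - r))"
    unfolding expand by (simp add: expand_ring)
  show "ham_x (Params a0 a1 a2 (a3 + a4) (- a4)) t x y z (w - r) =
      ham_x (Params a0 a1 a2 a3 a4) t x y z w"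
    unfolding expand by (simp add: expand_ring)
  show "ham_y (Params a0 a1 a2 (a3 + a4) (- a4)) t x y z (w - r) =
      ham_y (Params a0 a1 a2 a3 a4) t x y z w"
    unfolding expand by (simp add: expand_ring)
  show "ham_w (Params a0 a1 a2 (a3 + a4) (- a4)) t x y z (w - r) =
      ham_w (Params a0 a1 a2 a3 a4) t x y z w"
    unfolding expand by (simp add: expand_ring)
qed

text \<open>Here \<open>f = y + w\<^sup>2 - t\<close> depends on two coordinates and on time, and \<open>df\<close> is \<open>t (t - 1)\<close> times its
  derivative along the flow. In the second identity, the term with \<open>ham_z\<close> comes from the derivative of
  the factor \<open>w\<close> in the shift \<open>2 r w\<close> of \<open>z\<close>.\<close>

lemma s3_vector_field:
  fixes a0 a1 a2 a3 a4 t x y z w r f :: complex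
  defines "a \<equiv> Params a0 a1 a2 a3 a4" and "b \<equiv> Params a0 a1 (a2 + a3) (- a3) (a4 + 2 * a3)"
  defines "df \<equiv> - ham_x a t x y z w - 2 * w * ham_z a t x y z w - t * (t - 1)"
  assumes "a0 + a1 + 2 * a2 + 2 * a3 + a4 = 1" "a3 = r * f" "y = f - w^2 + t"
  shows "- r * df = f * (ham_y b t (x + r) y (z + 2 * r * w) w - ham_y a t x y z w)"
    and "- 2 * r * w * df = f * (ham_w b t (x + r) y (z + 2 * r * w) w - ham_w a t x y z w + 2 * r * ham_z a t x y z w)"
    and "ham_x b t (x + r) y (z + 2 * r * w) w = ham_x a t x y z w"
    and "ham_z b t (x + r) y (z + 2 * r * w) w = ham_z a t x y z w"
proof -
  have a0: "a0 = 1 - a1 - 2 * a2 - 2 * a3 - a4"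
    using assms(4) by (simp add: algebra_simps)
  note expand = a_def b_def df_def ham_x.simps ham_y.simps ham_z.simps ham_w.simps a0 assms(5,6)
  show "- r * df = f * (ham_y b t (x + r) y (z + 2 * r * w) w - ham_y a t x y z w)"
    unfolding expand by (simp add: expand_ring)
  show "- 2 * r * w * df = f * (ham_w b t (x + r) y (z + 2 * r * w) w - ham_w a t x y z w + 2 * r * ham_z a t x y z w)"
    unfolding expand by (simp add: expand_ring)
  show "ham_x b t (x + r) y (z + 2 * r * w) w = ham_x a t x y z w"
    unfolding expand by (simp add: expand_ring)
  show "ham_z b t (x + r) y (z + 2 * r * w) w = ham_z a t x y z w"
    unfolding expand by (simp add: expand_ring)
qed

text \<open>The transformation is canonical and turns \<open>t (t - 1) H\<close> into its negative, up to a term free of the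
  coordinates. The sign matches the reversal of time.\<close>

lemma pi_vector_field:
  assumes "a0 + a1 + 2 * a2 + 2 * a3 + a4 = 1"
  shows "ham_x (Params a1 a0 a2 a3 a4) (1 - t) (- x) (1 - y) (\<i> * z) (w / \<i>) =
      ham_x (Params a0 a1 a2 a3 a4) t x y z w"
    and "ham_y (Params a1 a0 a2 a3 a4) (1 - t) (- x) (1 - y) (\<i> * z) (w / \<i>) =
        ham_y (Params a0 a1 a2 a3 a4) t x y z w"
    and "ham_z (Params a1 a0 a2 a3 a4) (1 - t) (- x) (1 - y) (\<i> * z) (w / \<i>) =
        \<i> * ham_z (Params a0 a1 a2 a3 a4) t x y z w"
    and "ham_w (Params a1 a0 a2 a3 a4) (1 - t) (- x) (1 - y) (\<i> * z) (w / \<i>) =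
        - \<i> * ham_w (Params a0 a1 a2 a3 a4) t x y z w"
proof -
  have w: "w / \<i> = - \<i> * w" and i: "\<i> * \<i> = -1"
    by simp_all
  have i': "\<i> * (\<i> * u) = - u" for u
    by (simp flip: mult.assoc)
  have a0: "a0 = 1 - a1 - 2 * a2 - 2 * a3 - a4"
    using assms by (simp add: algebra_simps)
  show "ham_x (Params a1 a0 a2 a3 a4) (1 - t) (- x) (1 - y) (\<i> * z) (w / \<i>) =
      ham_x (Params a0 a1 a2 a3 a4) t x y z w"
    and "ham_y (Params a1 a0 a2 a3 a4) (1 - t) (- x) (1 - y) (\<i> * z) (w / \<i>) =
        ham_y (Params a0 a1 a2 a3 a4) t x y z w"
    and "ham_z (Params a1 a0 a2 a3 a4) (1 - t) (- x) (1 - y) (\<i> * z) (w / \<i>) =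
        \<i> * ham_z (Params a0 a1 a2 a3 a4) t x y z w"
    and "ham_w (Params a1 a0 a2 a3 a4) (1 - t) (- x) (1 - y) (\<i> * z) (w / \<i>) =
        - \<i> * ham_w (Params a0 a1 a2 a3 a4) t x y z w"
    unfolding ham_x.simps ham_y.simps ham_z.simps ham_w.simps w a0
    by (simp_all add: expand_ring i i')
qed

section \<open>Preservation of solutions\<close>

text \<open>A denominator that does not vanish at a point does not vanish nearby.\<close>

lemma regular_at_nearby:
  assumes "regular_at f (\<gamma> 0)" and cont: "\<And>v. isCont (\<lambda>s. coord (\<gamma> s) v) 0"
  shows "\<forall>\<^sub>F s in at (0::complex). regular_at f (\<gamma> s)"
proof -
  obtain p q where f: "f = Fract p q" and q: "pol_value q (\<gamma> 0) \<noteq> 0"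
    using assms(1) by (auto simp: regular_at_def)
  have "isCont (\<lambda>s. pol_value q (\<gamma> s)) 0"
    unfolding pol_value_def by (intro continuous_intros cont)
  then have "\<forall>\<^sub>F s in at 0. pol_value q (\<gamma> s) \<noteq> 0"
    using q by (simp add: isCont_def tendsto_imp_eventually_ne)
  then show ?thesis
    by eventually_elim (auto simp: regular_at_def f)
qed

lemma isCont_coord:
  assumes "isCont p 0" "isCont q 0" "isCont r 0" "isCont u 0"
  shows "isCont (\<lambda>s. coord (Conf x y z w t (Params a0 (p s) (q s) (r s) (u s))) v) 0"
  using assms by (cases v) simp_all

text \<open>The curve \<open>\<gamma>\<close> moves a parameter so that the numerator \<open>g\<close> varies linearly and \<open>d\<close> is
  constant. If \<open>d\<close> vanished along \<open>\<gamma>\<close>, then evaluating \<open>(f + g / d) d = f d + g\<close> would give \<open>g = 0\<close> wherever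
  \<open>f + g / d\<close> is regular, hence for all small \<open>s\<close>, while \<open>g\<close> has at most one zero on \<open>\<gamma>\<close>. Looking only
  at the given point would not suffice, as \<open>g\<close> may vanish there.\<close>

lemma denominator_nonzero_if_regular:
  assumes regular: "regular_at (f + g / d) (\<gamma> 0)" and "d \<noteq> 0"
    and cont: "\<And>v. isCont (\<lambda>s. coord (\<gamma> s) v) 0"
    and fgd: "\<And>s. regular_at f (\<gamma> s)" "\<And>s. regular_at g (\<gamma> s)" "\<And>s. regular_at d (\<gamma> s)"
    and d: "\<And>s. rat_value d (\<gamma> s) = d0"
    and g: "\<And>s. rat_value g (\<gamma> s) = g0 + k * s" "k \<noteq> 0"
  shows "d0 \<noteq> 0"
proof
  assume "d0 = 0"
  have pole: "g0 + k * s = 0" if "regular_at (f + g / d) (\<gamma> s)" for s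
  proof -
    have "(f + g / d) * d = f * d + g"
      using \<open>d \<noteq> 0\<close> by (simp add: field_simps)
    then have "rat_value ((f + g / d) * d) (\<gamma> s) = rat_value (f * d + g) (\<gamma> s)"
      by (simp only:)
    also have "rat_value ((f + g / d) * d) (\<gamma> s) = rat_value (f + g / d) (\<gamma> s) * rat_value d (\<gamma> s)"
      by (rule rat_value_simps) (simp_all add: that fgd)
    finally show ?thesis
      using fgd d g \<open>d0 = 0\<close> by simp
  qed
  have "\<forall>\<^sub>F s in at 0. s \<noteq> 0 \<and> regular_at (f + g / d) (\<gamma> s)"
    by (intro eventually_conj eventually_neq_at_within regular_at_nearby regular cont)
  then obtain s where "s \<noteq> 0" "regular_at (f + g / d) (\<gamma> s)"
    using eventually_happens[of _ "at (0::complex)"] by auto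
  then show False
    using pole[of s] pole[of 0] regular \<open>k \<noteq> 0\<close> by simp
qed

lemma pred_conf_iff:
  "pred_conf P c \<longleftrightarrow> P (cx c) \<and> P (cy c) \<and> P (cz c) \<and> P (cw c) \<and> P (ct c) \<and> pred_params P (cp c)"
  by (cases c) simp

text \<open>The value of \<open>\<alpha>\<^sub>0\<close> at a point is computed from the other parameters, so it is moved by moving
  \<open>\<alpha>\<^sub>1\<close>.\<close>

lemma regular_s0:
  assumes "regular_at (cx tr_s0) (Conf x y z w t a)"
  shows "y \<noteq> 1"
proof (cases a)
  case (Params a0 a1 a2 a3 a4)
  have "y - 1 \<noteq> 0"
    by (rule denominator_nonzero_if_regular[where f = "gen VX" and d = "gen VY - 1"
          and g = "1 - gen VA1 - 2 * gen VA2 - 2 * gen VA3 - gen VA4"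
          and \<gamma> = "\<lambda>s. Conf x y z w t (Params a0 (a1 + s) a2 a3 a4)"
          and k = "-1" and ?g0.0 = "1 - a1 - 2 * a2 - 2 * a3 - a4"])
      (use assms in \<open>simp_all add: tr_defs Params isCont_coord\<close>)
  then show ?thesis by simp
qed

lemma regular_s1:
  assumes "regular_at (cx tr_s1) (Conf x y z w t a)"
  shows "y \<noteq> 0"
proof (cases a)
  case (Params a0 a1 a2 a3 a4)
  show ?thesis
    by (rule denominator_nonzero_if_regular[where f = "gen VX" and d = "gen VY" and g = "gen VA1"
          and \<gamma> = "\<lambda>s. Conf x y z w t (Params a0 (a1 + s) a2 a3 a4)" and k = 1 and ?g0.0 = a1])
      (use assms in \<open>simp_all add: tr_defs Params isCont_coord\<close>)
qed

lemma regular_s2: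
  assumes "regular_at (cy tr_s2) (Conf x y z w t a)"
  shows "x \<noteq> 0"
proof (cases a)
  case (Params a0 a1 a2 a3 a4)
  show ?thesis
    by (rule denominator_nonzero_if_regular[where f = "gen VY" and d = "gen VX" and g = "- gen VA2"
          and \<gamma> = "\<lambda>s. Conf x y z w t (Params a0 a1 (a2 + s) a3 a4)" and k = "-1" and ?g0.0 = "- a2"])
      (use assms in \<open>simp_all add: tr_defs Params isCont_coord\<close>)
qed

lemma regular_s3:
  assumes "regular_at (cx tr_s3) (Conf x y z w t a)"
  shows "y + w\<^sup>2 - t \<noteq> 0"
proof (cases a)
  case (Params a0 a1 a2 a3 a4)
  show ?thesis
    by (rule denominator_nonzero_if_regular[where f = "gen VX" and d = "gen VY + gen VW ^ 2 - gen VT"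
          and g = "gen VA3"
          and \<gamma> = "\<lambda>s. Conf x y z w t (Params a0 a1 a2 (a3 + s) a4)" and k = 1 and ?g0.0 = a3])
      (use assms in \<open>simp_all add: tr_defs Params isCont_coord\<close>)
qed

lemma regular_s4:
  assumes "regular_at (cw tr_s4) (Conf x y z w t a)"
  shows "z \<noteq> 0"
proof (cases a)
  case (Params a0 a1 a2 a3 a4)
  show ?thesis
    by (rule denominator_nonzero_if_regular[where f = "gen VW" and d = "gen VZ" and g = "- gen VA4"
          and \<gamma> = "\<lambda>s. Conf x y z w t (Params a0 a1 a2 a3 (a4 + s))" and k = "-1" and ?g0.0 = "- a4"])
      (use assms in \<open>simp_all add: tr_defs Params isCont_coord\<close>)
qed

text \<open>The new parameters are chosen before the time, because a solution has constant parameters.\<close>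

lemma carries_solutions_fixing_time:
  assumes "ct \<tau> = gen VT"
    and "\<And>a x y z w. param_rel a \<Longrightarrow> \<exists>b X Y Z W. param_rel b \<and>
      (\<forall>t. t \<noteq> 0 \<longrightarrow> t \<noteq> 1 \<longrightarrow> system_at a x y z w t \<longrightarrow>
        pred_conf (\<lambda>f. regular_at f (Conf (x t) (y t) (z t) (w t) t a)) \<tau> \<longrightarrow>
        system_at b X Y Z W t \<and>
        map_conf (\<lambda>f. rat_value f (Conf (x t) (y t) (z t) (w t) t a)) \<tau> =
          Conf (X t) (Y t) (Z t) (W t) t b)"
  shows "carries_solutions \<tau>"
  unfolding carries_solutions_def Let_def
proof (intro allI impI)
  fix a D x y z w
  assume sol: "solution a D x y z w"
    and reg: "\<forall>t\<in>D. pred_conf (\<lambda>f. regular_at f (Conf (x t) (y t) (z t) (w t) t a)) \<tau>"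
  then have "param_rel a" by (simp add: solution_iff)
  from assms(2)[OF this, of x y z w] obtain b X Y Z W where "param_rel b"
    and "\<And>t. t \<in> D \<Longrightarrow> system_at b X Y Z W t \<and>
        map_conf (\<lambda>f. rat_value f (Conf (x t) (y t) (z t) (w t) t a)) \<tau> =
          Conf (X t) (Y t) (Z t) (W t) t b"
    using sol reg unfolding solution_iff by metis
  then show "\<exists>b X Y Z W.
      solution b ((\<lambda>t. rat_value (ct \<tau>) (Conf (x t) (y t) (z t) (w t) t a)) ` D) X Y Z W \<and>
      (\<forall>t\<in>D. map_conf (\<lambda>f. rat_value f (Conf (x t) (y t) (z t) (w t) t a)) \<tau> =
        Conf (X (rat_value (ct \<tau>) (Conf (x t) (y t) (z t) (w t) t a)))
          (Y (rat_value (ct \<tau>) (Conf (x t) (y t) (z t) (w t) t a)))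
          (Z (rat_value (ct \<tau>) (Conf (x t) (y t) (z t) (w t) t a)))
          (W (rat_value (ct \<tau>) (Conf (x t) (y t) (z t) (w t) t a)))
          (rat_value (ct \<tau>) (Conf (x t) (y t) (z t) (w t) t a)) b)"
    using sol by (intro exI[of _ b] exI[of _ X] exI[of _ Y] exI[of _ Z] exI[of _ W])
      (auto simp: assms(1) solution_iff)
qed

lemma carries_solutions_s0: "carries_solutions tr_s0"
proof (rule carries_solutions_fixing_time)
  fix a and x y z w :: "complex \<Rightarrow> complex"
  assume "param_rel a"
  obtain a0 a1 a2 a3 a4 where a: "a = Params a0 a1 a2 a3 a4" by (cases a)
  have relation: "a0 + a1 + 2 * a2 + 2 * a3 + a4 = 1"
    using \<open>param_rel a\<close> by (simp add: param_rel_def a)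
  define b where "b = Params (- a0) a1 (a2 + a0) a3 a4"
  define X where "X t = x t + a0 / (y t - 1)" for t
  have "system_at b X y z w t \<and> map_conf (\<lambda>f. rat_value f (Conf (x t) (y t) (z t) (w t) t a)) tr_s0 =
      Conf (X t) (y t) (z t) (w t) t b"
    if system: "system_at a x y z w t"
      and regular: "pred_conf (\<lambda>f. regular_at f (Conf (x t) (y t) (z t) (w t) t a)) tr_s0" for t
  proof
    have y: "y t - 1 \<noteq> 0"
      using regular_s0[of "x t" "y t" "z t" "w t" t a] regular by (simp add: pred_conf_iff)
    define r where "r = a0 / (y t - 1)"
    have "a0 = r * (y t - 1)" using y by (simp add: r_def)
    note vf = s0_vector_field[OF relation this, of t "x t" "z t" "w t", folded a b_def]
    note deriv = system_atD[OF system]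
    have X: "X t = x t + r" by (simp add: X_def r_def)
    have "(X has_field_derivative ham_y a t (x t) (y t) (z t) (w t) / (t * (t - 1)) +
        r * ham_x a t (x t) (y t) (z t) (w t) / ((y t - 1) * (t * (t - 1)))) (at t)"
      unfolding X_def using y
      by (auto intro!: derivative_eq_intros deriv simp: r_def)
    also have "r * ham_x a t (x t) (y t) (z t) (w t) / ((y t - 1) * (t * (t - 1))) =
       (ham_y b t (X t) (y t) (z t) (w t) - ham_y a t (x t) (y t) (z t) (w t)) / (t * (t - 1))"
      unfolding vf(1) using y by (simp add: X)
    finally show "system_at b X y z w t"
      using deriv vf(2-4) by (simp add: system_at_def diff_divide_distrib X)
    show "map_conf (\<lambda>f. rat_value f (Conf (x t) (y t) (z t) (w t) t a)) tr_s0 =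
        Conf (X t) (y t) (z t) (w t) t b"
      using relation y by (simp add: tr_defs a b_def X_def) (simp add: algebra_simps)
  qed
  moreover have "param_rel b"
    using relation by (simp add: param_rel_def b_def algebra_simps)
  ultimately show "\<exists>b X Y Z W. param_rel b \<and> (\<forall>t. t \<noteq> 0 \<longrightarrow> t \<noteq> 1 \<longrightarrow> system_at a x y z w t \<longrightarrow>
      pred_conf (\<lambda>f. regular_at f (Conf (x t) (y t) (z t) (w t) t a)) tr_s0 \<longrightarrow>
      system_at b X Y Z W t \<and> map_conf (\<lambda>f. rat_value f (Conf (x t) (y t) (z t) (w t) t a)) tr_s0 =
        Conf (X t) (Y t) (Z t) (W t) t b)"
    by blast
qed (simp add: tr_defs)

lemma carries_solutions_s1: "carries_solutions tr_s1"
proof (rule carries_solutions_fixing_time)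
  fix a and x y z w :: "complex \<Rightarrow> complex"
  assume "param_rel a"
  obtain a0 a1 a2 a3 a4 where a: "a = Params a0 a1 a2 a3 a4" by (cases a)
  have relation: "a0 + a1 + 2 * a2 + 2 * a3 + a4 = 1"
    using \<open>param_rel a\<close> by (simp add: param_rel_def a)
  define b where "b = Params a0 (- a1) (a2 + a1) a3 a4"
  define X where "X t = x t + a1 / y t" for t
  have "system_at b X y z w t \<and> map_conf (\<lambda>f. rat_value f (Conf (x t) (y t) (z t) (w t) t a)) tr_s1 =
      Conf (X t) (y t) (z t) (w t) t b"
    if system: "system_at a x y z w t"
      and regular: "pred_conf (\<lambda>f. regular_at f (Conf (x t) (y t) (z t) (w t) t a)) tr_s1" for t
  proof
    have y: "y t \<noteq> 0"
      using regular_s1[of "x t" "y t" "z t" "w t" t a] regular by (simp add: pred_conf_iff)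
    define r where "r = a1 / y t"
    have "a1 = r * y t" using y by (simp add: r_def)
    note vf = s1_vector_field[OF relation this, of t "x t" "z t" "w t", folded a b_def]
    note deriv = system_atD[OF system]
    have X: "X t = x t + r" by (simp add: X_def r_def)
    have "(X has_field_derivative ham_y a t (x t) (y t) (z t) (w t) / (t * (t - 1)) +
        r * ham_x a t (x t) (y t) (z t) (w t) / (y t * (t * (t - 1)))) (at t)"
      unfolding X_def using y
      by (auto intro!: derivative_eq_intros deriv simp: r_def)
    also have "r * ham_x a t (x t) (y t) (z t) (w t) / (y t * (t * (t - 1))) =
       (ham_y b t (X t) (y t) (z t) (w t) - ham_y a t (x t) (y t) (z t) (w t)) / (t * (t - 1))"
      unfolding vf(1) using y by (simp add: X)
    finally show "system_at b X y z w t"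
      using deriv vf(2-4) by (simp add: system_at_def diff_divide_distrib X)
    show "map_conf (\<lambda>f. rat_value f (Conf (x t) (y t) (z t) (w t) t a)) tr_s1 =
        Conf (X t) (y t) (z t) (w t) t b"
      using relation y by (simp add: tr_defs a b_def X_def) (simp add: algebra_simps)
  qed
  moreover have "param_rel b"
    using relation by (simp add: param_rel_def b_def algebra_simps)
  ultimately show "\<exists>b X Y Z W. param_rel b \<and> (\<forall>t. t \<noteq> 0 \<longrightarrow> t \<noteq> 1 \<longrightarrow> system_at a x y z w t \<longrightarrow>
      pred_conf (\<lambda>f. regular_at f (Conf (x t) (y t) (z t) (w t) t a)) tr_s1 \<longrightarrow>
      system_at b X Y Z W t \<and> map_conf (\<lambda>f. rat_value f (Conf (x t) (y t) (z t) (w t) t a)) tr_s1 =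
        Conf (X t) (Y t) (Z t) (W t) t b)"
    by blast
qed (simp add: tr_defs)

lemma carries_solutions_s2: "carries_solutions tr_s2"
proof (rule carries_solutions_fixing_time)
  fix a and x y z w :: "complex \<Rightarrow> complex"
  assume "param_rel a"
  obtain a0 a1 a2 a3 a4 where a: "a = Params a0 a1 a2 a3 a4" by (cases a)
  have relation: "a0 + a1 + 2 * a2 + 2 * a3 + a4 = 1"
    using \<open>param_rel a\<close> by (simp add: param_rel_def a)
  define b where "b = Params (a0 + a2) (a1 + a2) (- a2) (a3 + a2) a4"
  define Y where "Y t = y t - a2 / x t" for t
  have "system_at b x Y z w t \<and> map_conf (\<lambda>f. rat_value f (Conf (x t) (y t) (z t) (w t) t a)) tr_s2 =
      Conf (x t) (Y t) (z t) (w t) t b"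
    if system: "system_at a x y z w t"
      and regular: "pred_conf (\<lambda>f. regular_at f (Conf (x t) (y t) (z t) (w t) t a)) tr_s2" for t
  proof
    have x: "x t \<noteq> 0"
      using regular_s2[of "x t" "y t" "z t" "w t" t a] regular by (simp add: pred_conf_iff)
    define r where "r = a2 / x t"
    have "a2 = r * x t" using x by (simp add: r_def)
    note vf = s2_vector_field[OF relation this, of t "y t" "z t" "w t", folded a b_def]
    note deriv = system_atD[OF system]
    have Y: "Y t = y t - r" by (simp add: Y_def r_def)
    have "(Y has_field_derivative - ham_x a t (x t) (y t) (z t) (w t) / (t * (t - 1)) +
        r * ham_y a t (x t) (y t) (z t) (w t) / (x t * (t * (t - 1)))) (at t)"
      unfolding Y_def using x
      by (auto intro!: derivative_eq_intros deriv simp: r_def)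
    also have "r * ham_y a t (x t) (y t) (z t) (w t) / (x t * (t * (t - 1))) =
       (ham_x a t (x t) (y t) (z t) (w t) - ham_x b t (x t) (Y t) (z t) (w t)) / (t * (t - 1))"
      unfolding vf(1) using x by (simp add: Y)
    finally show "system_at b x Y z w t"
      using deriv vf(2-4) by (simp add: system_at_def diff_divide_distrib Y)
    show "map_conf (\<lambda>f. rat_value f (Conf (x t) (y t) (z t) (w t) t a)) tr_s2 =
        Conf (x t) (Y t) (z t) (w t) t b"
      using relation x by (simp add: tr_defs a b_def Y_def) (simp add: algebra_simps)
  qed
  moreover have "param_rel b"
    using relation by (simp add: param_rel_def b_def algebra_simps)
  ultimately show "\<exists>b X Y Z W. param_rel b \<and> (\<forall>t. t \<noteq> 0 \<longrightarrow> t \<noteq> 1 \<longrightarrow> system_at a x y z w t \<longrightarrow>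
      pred_conf (\<lambda>f. regular_at f (Conf (x t) (y t) (z t) (w t) t a)) tr_s2 \<longrightarrow>
      system_at b X Y Z W t \<and> map_conf (\<lambda>f. rat_value f (Conf (x t) (y t) (z t) (w t) t a)) tr_s2 =
        Conf (X t) (Y t) (Z t) (W t) t b)"
    by blast
qed (simp add: tr_defs)

lemma carries_solutions_s3: "carries_solutions tr_s3"
proof (rule carries_solutions_fixing_time)
  fix a and x y z w :: "complex \<Rightarrow> complex"
  assume "param_rel a"
  obtain a0 a1 a2 a3 a4 where a: "a = Params a0 a1 a2 a3 a4" by (cases a)
  have relation: "a0 + a1 + 2 * a2 + 2 * a3 + a4 = 1"
    using \<open>param_rel a\<close> by (simp add: param_rel_def a)
  define b where "b = Params a0 a1 (a2 + a3) (- a3) (a4 + 2 * a3)"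
  define f where "f t = y t + w t ^ 2 - t" for t
  define X where "X t = x t + a3 / f t" for t
  define Z where "Z t = z t + 2 * a3 * w t / f t" for t
  have "system_at b X y Z w t \<and> map_conf (\<lambda>f. rat_value f (Conf (x t) (y t) (z t) (w t) t a)) tr_s3 =
      Conf (X t) (y t) (Z t) (w t) t b"
    if system: "system_at a x y z w t" and "t \<noteq> 0" "t \<noteq> 1"
      and regular: "pred_conf (\<lambda>f. regular_at f (Conf (x t) (y t) (z t) (w t) t a)) tr_s3" for t
  proof
    have f: "f t \<noteq> 0"
      using regular_s3[of "x t" "y t" "z t" "w t" t a] regular by (simp add: pred_conf_iff f_def)
    define r where "r = a3 / f t"
    have r: "a3 = r * f t" using f by (simp add: r_def)
    have y: "y t = f t - w t ^ 2 + t" by (simp add: f_def)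
    define T where "T = t * (t - 1)"
    define df where "df = - ham_x a t (x t) (y t) (z t) (w t) - 2 * w t * ham_z a t (x t) (y t) (z t) (w t) - T"
    note vf = s3_vector_field[OF relation r y, of "x t" "z t", folded a b_def T_def, folded df_def]
    have X: "X t = x t + r" and Z: "Z t = z t + 2 * r * w t"
      by (simp_all add: X_def Z_def r_def)
    note deriv = system_atD[OF system, folded T_def]
    have "T \<noteq> 0" using \<open>t \<noteq> 0\<close> \<open>t \<noteq> 1\<close> by (simp add: T_def)
    have df: "(f has_field_derivative df / T) (at t)"
      unfolding f_def using \<open>T \<noteq> 0\<close>
      by (auto intro!: derivative_eq_intros deriv simp: df_def field_simps)
    have "(X has_field_derivative ham_y a t (x t) (y t) (z t) (w t) / T + - r * df / (f t * T)) (at t)"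
      unfolding X_def using f
      by (auto intro!: derivative_eq_intros df deriv simp: r_def)
    also have "- r * df / (f t * T) =
       (ham_y b t (X t) (y t) (Z t) (w t) - ham_y a t (x t) (y t) (z t) (w t)) / T"
      unfolding vf(1) X Z using f by simp
    finally have dX: "(X has_field_derivative ham_y b t (X t) (y t) (Z t) (w t) / T) (at t)"
      by (simp add: diff_divide_distrib)
    have "(Z has_field_derivative ham_w a t (x t) (y t) (z t) (w t) / T
        - 2 * r * ham_z a t (x t) (y t) (z t) (w t) / T + - 2 * r * w t * df / (f t * T)) (at t)"
      unfolding Z_def using f
      by (auto intro!: derivative_eq_intros df deriv simp: r_def field_simps)
    also have "- 2 * r * w t * df / (f t * T) =
       (ham_w b t (X t) (y t) (Z t) (w t) - ham_w a t (x t) (y t) (z t) (w t)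
        + 2 * r * ham_z a t (x t) (y t) (z t) (w t)) / T"
      unfolding vf(2) X Z using f by simp
    finally have dZ: "(Z has_field_derivative ham_w b t (X t) (y t) (Z t) (w t) / T) (at t)"
      by (simp add: diff_divide_distrib add_divide_distrib)
    show "system_at b X y Z w t"
      using deriv dX dZ vf(3,4) by (simp add: system_at_def X Z flip: T_def)
    show "map_conf (\<lambda>f. rat_value f (Conf (x t) (y t) (z t) (w t) t a)) tr_s3 =
        Conf (X t) (y t) (Z t) (w t) t b"
      using relation f by (simp add: tr_defs a b_def X_def Z_def f_def) (simp add: algebra_simps)
  qed
  moreover have "param_rel b"
    using relation by (simp add: param_rel_def b_def algebra_simps)
  ultimately show "\<exists>b X Y Z W. param_rel b \<and> (\<forall>t. t \<noteq> 0 \<longrightarrow> t \<noteq> 1 \<longrightarrow> system_at a x y z w t \<longrightarrow>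
      pred_conf (\<lambda>f. regular_at f (Conf (x t) (y t) (z t) (w t) t a)) tr_s3 \<longrightarrow>
      system_at b X Y Z W t \<and> map_conf (\<lambda>f. rat_value f (Conf (x t) (y t) (z t) (w t) t a)) tr_s3 =
        Conf (X t) (Y t) (Z t) (W t) t b)"
    by blast
qed (simp add: tr_defs)

lemma carries_solutions_s4: "carries_solutions tr_s4"
proof (rule carries_solutions_fixing_time)
  fix a and x y z w :: "complex \<Rightarrow> complex"
  assume "param_rel a"
  obtain a0 a1 a2 a3 a4 where a: "a = Params a0 a1 a2 a3 a4" by (cases a)
  have relation: "a0 + a1 + 2 * a2 + 2 * a3 + a4 = 1"
    using \<open>param_rel a\<close> by (simp add: param_rel_def a)
  define b where "b = Params a0 a1 a2 (a3 + a4) (- a4)"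
  define W where "W t = w t - a4 / z t" for t
  have "system_at b x y z W t \<and> map_conf (\<lambda>f. rat_value f (Conf (x t) (y t) (z t) (w t) t a)) tr_s4 =
      Conf (x t) (y t) (z t) (W t) t b"
    if system: "system_at a x y z w t"
      and regular: "pred_conf (\<lambda>f. regular_at f (Conf (x t) (y t) (z t) (w t) t a)) tr_s4" for t
  proof
    have z: "z t \<noteq> 0"
      using regular_s4[of "x t" "y t" "z t" "w t" t a] regular by (simp add: pred_conf_iff)
    define r where "r = a4 / z t"
    have "a4 = r * z t" using z by (simp add: r_def)
    note vf = s4_vector_field[OF relation this, of t "x t" "y t" "w t", folded a b_def]
    note deriv = system_atD[OF system]
    have W: "W t = w t - r" by (simp add: W_def r_def)
    have "(W has_field_derivative - ham_z a t (x t) (y t) (z t) (w t) / (t * (t - 1)) +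
        r * ham_w a t (x t) (y t) (z t) (w t) / (z t * (t * (t - 1)))) (at t)"
      unfolding W_def using z
      by (auto intro!: derivative_eq_intros deriv simp: r_def)
    also have "r * ham_w a t (x t) (y t) (z t) (w t) / (z t * (t * (t - 1))) =
       (ham_z a t (x t) (y t) (z t) (w t) - ham_z b t (x t) (y t) (z t) (W t)) / (t * (t - 1))"
      unfolding vf(1) using z by (simp add: W)
    finally show "system_at b x y z W t"
      using deriv vf(2-4) by (simp add: system_at_def diff_divide_distrib W)
    show "map_conf (\<lambda>f. rat_value f (Conf (x t) (y t) (z t) (w t) t a)) tr_s4 =
        Conf (x t) (y t) (z t) (W t) t b"
      using relation z by (simp add: tr_defs a b_def W_def) (simp add: algebra_simps)
  qed
  moreover have "param_rel b"
    using relation by (simp add: param_rel_def b_def algebra_simps)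
  ultimately show "\<exists>b X Y Z W. param_rel b \<and> (\<forall>t. t \<noteq> 0 \<longrightarrow> t \<noteq> 1 \<longrightarrow> system_at a x y z w t \<longrightarrow>
      pred_conf (\<lambda>f. regular_at f (Conf (x t) (y t) (z t) (w t) t a)) tr_s4 \<longrightarrow>
      system_at b X Y Z W t \<and> map_conf (\<lambda>f. rat_value f (Conf (x t) (y t) (z t) (w t) t a)) tr_s4 =
        Conf (X t) (Y t) (Z t) (W t) t b)"
    by blast
qed (simp add: tr_defs)

lemma carries_solutions_pi: "carries_solutions tr_pi"
  unfolding carries_solutions_def Let_def
proof (intro allI impI)
  fix a D and x y z w :: "complex \<Rightarrow> complex"
  assume sol: "solution a D x y z w"
  obtain a0 a1 a2 a3 a4 where a: "a = Params a0 a1 a2 a3 a4" by (cases a)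
  have relation: "a0 + a1 + 2 * a2 + 2 * a3 + a4 = 1"
    using sol by (simp add: solution_def param_rel_def a)
  define b where "b = Params a1 a0 a2 a3 a4"
  define X Y Z W where "X s = - x (1 - s)" and "Y s = 1 - y (1 - s)"
    and "Z s = \<i> * z (1 - s)" and "W s = w (1 - s) / \<i>" for s
  note XYZW = X_def Y_def Z_def W_def
  have system: "system_at b X Y Z W (1 - t)" if "t \<in> D" for t
  proof -
    have reflect: "((\<lambda>s. g (1 - s)) has_field_derivative - g') (at (1 - t))"
      if "(g has_field_derivative g') (at t)" for g' and g :: "complex \<Rightarrow> complex"
    proof -
      have "((\<lambda>s. 1 - s) has_field_derivative -1) (at (1 - t))"
        by (auto intro!: derivative_eq_intros)
      then show ?thesis
        using DERIV_chain2[of g g' "\<lambda>s. 1 - s" "1 - t" "-1"] that by simp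
    qed
    have "system_at a x y z w t" using sol that by (simp add: solution_iff)
    note deriv = system_atD[OF this, THEN reflect]
    note vf = pi_vector_field[OF relation, of t "x t" "y t" "z t" "w t", folded a b_def]
    have T: "(1 - t) * (1 - t - 1) = t * (t - 1)" by (simp add: algebra_simps)
    show ?thesis
      unfolding system_at_def T
      using DERIV_minus[OF deriv(1)] DERIV_diff[OF DERIV_const[of 1] deriv(2)]
        DERIV_cmult[OF deriv(3), of \<i>] DERIV_cdivide[OF deriv(4), of \<i>]
      by (simp add: XYZW[abs_def] vf[simplified])
  qed
  have "open ((\<lambda>t. 1 - t) ` D)"
  proof -
    have "(\<lambda>t. 1 - t) ` D = (\<lambda>t. 1 - t) -` D" by (force simp: image_iff)
    moreover have "open ((\<lambda>t. 1 - t) -` D)"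
      using sol by (intro open_vimage continuous_intros) (simp add: solution_iff)
    ultimately show ?thesis by simp
  qed
  moreover have "0 \<notin> (\<lambda>t. 1 - t) ` D" "1 \<notin> (\<lambda>t. 1 - t) ` D"
    using sol by (auto simp: solution_iff)
  moreover have "param_rel b"
    using relation by (simp add: param_rel_def b_def algebra_simps)
  ultimately have "solution b ((\<lambda>t. 1 - t) ` D) X Y Z W"
    using system by (simp add: solution_iff)
  then show "\<exists>b X Y Z W.
      solution b ((\<lambda>t. rat_value (ct tr_pi) (Conf (x t) (y t) (z t) (w t) t a)) ` D) X Y Z W \<and>
      (\<forall>t\<in>D. map_conf (\<lambda>f. rat_value f (Conf (x t) (y t) (z t) (w t) t a)) tr_pi =
        Conf (X (rat_value (ct tr_pi) (Conf (x t) (y t) (z t) (w t) t a)))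
          (Y (rat_value (ct tr_pi) (Conf (x t) (y t) (z t) (w t) t a)))
          (Z (rat_value (ct tr_pi) (Conf (x t) (y t) (z t) (w t) t a)))
          (W (rat_value (ct tr_pi) (Conf (x t) (y t) (z t) (w t) t a)))
          (rat_value (ct tr_pi) (Conf (x t) (y t) (z t) (w t) t a)) b)"
    using relation by (intro exI[of _ b] exI[of _ X] exI[of _ Y] exI[of _ Z] exI[of _ W])
      (auto simp: tr_defs a b_def XYZW algebra_simps)
qed

section \<open>Birationality\<close>

lemma pol_value_mvar [simp]: "pol_value (mvar v) c = coord c v"
  by (simp add: pol_value_eq_eval complex_coeff.eval_var)

lemma pol_value_one [simp]: "pol_value 1 c = 1"
  by (rule at_point.h_one)

lemma pol_value_add [simp]: "pol_value (p + q) c = pol_value p c + pol_value q c"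
  by (rule at_point.h_add)

lemma pol_value_diff [simp]: "pol_value (p - q) c = pol_value p c - pol_value q c"
  using at_point.h_add[of p "- q" c] by (simp add: at_point.h_minus)

lemma pol_value_mult [simp]: "pol_value (p * q) c = pol_value p c * pol_value q c"
  by (rule at_point.h_mult)

text \<open>In all six cases the map and its inverse are defined off the zero set of the same polynomial \<open>d\<close>,
  and leave \<open>d\<close> unchanged, so that one \<open>d\<close> serves both compositions.\<close>

lemma birational_xyzwI:
  assumes "\<And>t a. \<exists>x y z w. pol_value d (Conf x y z w t a) \<noteq> 0"
    and "\<And>x y z w t a. let c = Conf x y z w t a; F = (cx \<tau>, cy \<tau>, cz \<tau>, cw \<tau>) in
      pol_value d c \<noteq> 0 \<longrightarrow>
        ratmap_regular_at F c \<and> ratmap_regular_at G (ratmap_value F c) \<and>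
        ratmap_value G (ratmap_value F c) = c \<and>
        ratmap_regular_at G c \<and> ratmap_regular_at F (ratmap_value G c) \<and>
        ratmap_value F (ratmap_value G c) = c"
  shows "birational_xyzw \<tau>"
  unfolding birational_xyzw_def generic_left_inverse_def
  using assms unfolding Let_def by (intro allI impI exI[of _ G] conjI exI[of _ d]) blast+

lemma birational_s0: "birational_xyzw tr_s0"
  by (rule birational_xyzwI[where d = "mvar VY - 1"
        and G = "(gen VX - (1 - gen VA1 - 2 * gen VA2 - 2 * gen VA3 - gen VA4) / (gen VY - 1),
          gen VY, gen VZ, gen VW)"])
    (auto simp: tr_defs Let_def intro: exI[of _ 0])

lemma birational_s1: "birational_xyzw tr_s1"
  by (rule birational_xyzwI[where d = "mvar VY"
        and G = "(gen VX - gen VA1 / gen VY, gen VY, gen VZ, gen VW)"])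
    (auto simp: tr_defs Let_def intro: exI[of _ 1])

lemma birational_s2: "birational_xyzw tr_s2"
  by (rule birational_xyzwI[where d = "mvar VX"
        and G = "(gen VX, gen VY + gen VA2 / gen VX, gen VZ, gen VW)"])
    (auto simp: tr_defs Let_def intro: exI[of _ 1])

lemma birational_s3: "birational_xyzw tr_s3"
proof (rule birational_xyzwI[where d = "mvar VY + mvar VW * mvar VW - mvar VT"
      and G = "(gen VX - gen VA3 / (gen VY + gen VW ^ 2 - gen VT), gen VY,
        gen VZ - 2 * gen VA3 * gen VW / (gen VY + gen VW ^ 2 - gen VT), gen VW)"])
  show "\<exists>x y z w. pol_value (mvar VY + mvar VW * mvar VW - mvar VT) (Conf x y z w t a) \<noteq> 0" for t a
    by (intro exI[of _ "0::complex"] exI[of _ "t + 1"]) simp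
qed (simp add: tr_defs Let_def power2_eq_square)

lemma birational_s4: "birational_xyzw tr_s4"
  by (rule birational_xyzwI[where d = "mvar VZ"
        and G = "(gen VX, gen VY, gen VZ, gen VW + gen VA4 / gen VZ)"])
    (auto simp: tr_defs Let_def intro: exI[of _ 1])

lemma birational_pi: "birational_xyzw tr_pi"
  by (rule birational_xyzwI[where d = 1
        and G = "(- gen VX, 1 - gen VY, gen VZ / const \<i>, const \<i> * gen VW)"])
    (auto simp: tr_defs Let_def)

lemma baecklund_generators:
  "baecklund tr_s0 \<and> baecklund tr_s1 \<and> baecklund tr_s2 \<and> baecklund tr_s3 \<and> baecklund tr_s4 \<and> baecklund tr_pi"
  by (simp add: baecklund_def birational_s0 birational_s1 birational_s2 birational_s3 birational_s4
      birational_pi carries_solutions_s0 carries_solutions_s1 carries_solutions_s2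
      carries_solutions_s3 carries_solutions_s4 carries_solutions_pi)

section \<open>The extended affine Weyl group\<close>

theorem theorem2p1:
  shows "(baecklund tr_s0 \<and> baecklund tr_s1 \<and> baecklund tr_s2 \<and> baecklund tr_s3 \<and>
          baecklund tr_s4 \<and> baecklund tr_pi) \<and>
    (\<exists>S0 S1 S2 S3 S4 P :: ratfun \<Rightarrow> ratfun.
      (induces tr_s0 S0 \<and> induces tr_s1 S1 \<and> induces tr_s2 S2 \<and> induces tr_s3 S3 \<and>
       induces tr_s4 S4 \<and> induces tr_pi P) \<and>
      (S0 \<circ> S0 = id \<and> S1 \<circ> S1 = id \<and> S2 \<circ> S2 = id \<and> S3 \<circ> S3 = id \<and> S4 \<circ> S4 = id) \<and>
      ((S0 \<circ> S2) ^^ 3 = id \<and> (S1 \<circ> S2) ^^ 3 = id \<and> (S2 \<circ> S3) ^^ 3 = id \<and>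
       (S3 \<circ> S4) ^^ 4 = id) \<and>
      (S0 \<circ> S1 = S1 \<circ> S0 \<and> S0 \<circ> S3 = S3 \<circ> S0 \<and> S0 \<circ> S4 = S4 \<circ> S0 \<and>
       S1 \<circ> S3 = S3 \<circ> S1 \<and> S1 \<circ> S4 = S4 \<circ> S1 \<and> S2 \<circ> S4 = S4 \<circ> S2) \<and>
      (P \<circ> S0 = S1 \<circ> P \<and> P \<circ> S1 = S0 \<circ> P \<and> P \<circ> S2 = S2 \<circ> P \<and>
       P \<circ> S3 = S3 \<circ> P \<and> P \<circ> S4 = S4 \<circ> P))"
proof (rule conjI[OF baecklund_generators], intro exI conjI)
  show "subst_ratfun tr_s0 \<circ> subst_ratfun tr_s0 = id" "subst_ratfun tr_s1 \<circ> subst_ratfun tr_s1 = id"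
    "subst_ratfun tr_s2 \<circ> subst_ratfun tr_s2 = id" "subst_ratfun tr_s3 \<circ> subst_ratfun tr_s3 = id"
    "subst_ratfun tr_s4 \<circ> subst_ratfun tr_s4 = id"
    by (simp_all add: inverse_substitutions involutions)
  then show "(subst_ratfun tr_s0 \<circ> subst_ratfun tr_s2) ^^ 3 = id"
    "(subst_ratfun tr_s1 \<circ> subst_ratfun tr_s2) ^^ 3 = id"
    "(subst_ratfun tr_s2 \<circ> subst_ratfun tr_s3) ^^ 3 = id"
    "(subst_ratfun tr_s3 \<circ> subst_ratfun tr_s4) ^^ 4 = id"
    using braid_s0_s2 braid_s1_s2 braid_s3_s2[symmetric] braid_s3_s4
    by (blast intro: order_3_if_braid order_4_if_braid)+
qed (rule induces_generators commuting_generators pi_conjugation)+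

end
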